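(* Let $f(x)=(1-x)^{\alpha}(1+x)^{\beta}g(x)$ on $[-1,1]$, where $\alpha,\beta\ge 0$ are real numbers that are not both integers and $g\in C^{\infty}[-1,1]$. Define $$s=\begin{cases}2\min\{\alpha,\beta\}, & \text{if neither }\alpha\text{ nor }\beta\text{ is an integer},\\ 2\alpha, & \text{if }\beta\text{ is an integer},\\ 2\beta, & \text{if }\alpha\text{ is an integer}.\end{cases}$$ Then the error of the $(n+1)$-point Clenshaw-Curtis quadrature for the integral $\int_{-1}^1f(x)\,dx$ satisfies $$E_n^C[f]=\mathcal{O}(n^{-s-2}),\qquad n\to\infty.$$
   Context: The $(n+1)$-point Clenshaw-Curtis rule is $I_n^C[f]=\sum_{j=0}^n w_jf(x_j)$ with nodes $x_j=\cos(j\pi/n)$, $j=0,\dots,n$, and weights $$w_j=\frac{4\delta_j}{n}\sum_{k=0}^{\lfloor n/2\rfloor}\frac{\delta_{2k}}{1-4k^2}\cos\Big(\frac{2jk\pi}{n}\Big),$$ where $\delta_j=1/2$ if $j=0$ or $j=n$, and $\delta_j=1$ otherwise; equivalently, it is the interpolatory quadrature rule at these nodes (exact for polynomials of degree at most $n$). The error is $E_n^C[f]=\int_{-1}^1f(x)\,dx-I_n^C[f]$. The convention $0^0=1$ is used, i.e. a factor with exponent $0$ is identically $1$. *)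

theory Defs
  imports "HOL-Analysis.Analysis" "HOL-Library.Landau_Symbols"
begin

text \<open>
  Infinite differentiability on a set, with derivatives taken within the set; on a compact
  interval these are the one-sided derivatives at the endpoints.  \<open>G k\<close> is the \<open>k\<close>-th derivative
  (continuous, being itself differentiable); values outside the set are irrelevant.
\<close>
definition C_infinity_on :: "real set \<Rightarrow> (real \<Rightarrow> real) \<Rightarrow> bool" where
  "C_infinity_on S g \<longleftrightarrow>
     (\<exists>G :: nat \<Rightarrow> real \<Rightarrow> real.
        (\<forall>x\<in>S. G 0 x = g x) \<and>
        (\<forall>k. \<forall>x\<in>S. (G k has_real_derivative G (Suc k) x) (at x within S)))"

text \<open>
  Real powers of nonnegative bases with the convention $0^0 = 1$; the library has \<open>0 powr 0 = 0\<close>.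
\<close>
definition rpow :: "real \<Rightarrow> real \<Rightarrow> real" where
  "rpow x a = (if a = 0 then 1 else x powr a)"

text \<open>The definitions below are meaningful for \<open>n \<ge> 1\<close> only.\<close>

definition cc_delta :: "nat \<Rightarrow> nat \<Rightarrow> real" where
  "cc_delta n j = (if j = 0 \<or> j = n then 1 / 2 else 1)"

definition cc_node :: "nat \<Rightarrow> nat \<Rightarrow> real" where
  "cc_node n j = cos (real j * pi / real n)"

definition cc_weight :: "nat \<Rightarrow> nat \<Rightarrow> real" where
  "cc_weight n j = 4 * cc_delta n j / real n *
     (\<Sum>k = 0..n div 2. cc_delta n (2 * k) / (1 - 4 * (real k)\<^sup>2) *
        cos (2 * real j * real k * pi / real n))"

definition clenshaw_curtis :: "nat \<Rightarrow> (real \<Rightarrow> real) \<Rightarrow> real" where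
  "clenshaw_curtis n f = (\<Sum>j = 0..n. cc_weight n j * f (cc_node n j))"

definition cc_error :: "nat \<Rightarrow> (real \<Rightarrow> real) \<Rightarrow> real" where
  "cc_error n f = integral {-1..1} f - clenshaw_curtis n f"

end

theory Submission
  imports Defs "HOL-Computational_Algebra.Polynomial"
begin

text \<open>
  The order \<open>n powr (- s - 2)\<close> is decided by the endpoint singularities alone.  For a single
  fractional power \<open>(1 - x) powr \<gamma>\<close> the error can be computed almost exactly, and everything that
  is left over is so smooth that crude estimates suffice.

  \<^emph>\<open>The fractional power.\<close>  Write \<open>\<gamma> = m + \<sigma>\<close> with \<open>0 < \<sigma> < 1\<close> and \<open>y = 1 - x\<close>.  Up to a positive
  constant, \<open>y powr \<gamma>\<close> is the integral of \<open>v powr (\<sigma> - 1) * y ^ (m + 1) / (y + v)\<close> over \<open>v > 0\<close>, so by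
  Fubini its error is an integral of errors for \<open>y ^ (m + 1) / (y + v)\<close>.  Modulo polynomials, on which
  the rule is exact (\<open>cc_error_poly\<close>), the latter function is \<open>(-v) ^ (m + 1)\<close> times the Cauchy kernel
  \<open>1 / (t - x)\<close>, \<open>t = 1 + v\<close>.  For the kernel let \<open>W\<close> be the polynomial with
  \<open>W(cos \<theta>) = sin \<theta> sin (n\<theta>)\<close>, which vanishes at the nodes: the kernel minus its interpolant is
  \<open>W(x) / (W(t) (t - x))\<close>, hence its error is the integral of \<open>W(x) / (t - x)\<close> divided by \<open>W(t)\<close>.
  One integration by parts in \<open>\<theta>\<close> bounds the integral by \<open>4 / n\<close>, while
  \<open>\<bar>W(cosh u)\<bar> = sinh u sinh (nu)\<close> grows like powers of \<open>n\<^sup>2 v\<close>.  The substitution \<open>z = n\<^sup>2 v\<close> then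
  leaves a convergent integral in front of \<open>n powr (- 2 * \<gamma> - 2)\<close>
  (\<open>cc_error_one_minus_power_bigo\<close>).

  \<^emph>\<open>The smooth remainder.\<close>  A function with \<open>K\<close> derivatives is approximated by polynomials of degree
  \<open>n\<close> to order \<open>n powr (- K / 2)\<close>: Bernstein polynomials approximate a Lipschitz function to order
  \<open>n powr (- 1 / 2)\<close>, and one differentiates and integrates \<open>K\<close> times.  This rate is far from optimal,
  but \<open>K\<close> is at our disposal, and so it does not matter either that the weights are only
  bounded by a constant each (\<open>cc_error_cont_diff_bigo\<close>).

  \<^emph>\<open>The splitting.\<close>  In \<open>(1 - x) powr \<alpha> * h x\<close> with \<open>h\<close> smooth, subtract the Taylor polynomial of
  \<open>h\<close> at \<open>1\<close>.  It contributes finitely many powers \<open>(1 - x) powr (\<alpha> + i)\<close>; the remainder vanishes at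
  \<open>1\<close> to high order, so that its product with \<open>(1 - x) powr \<alpha>\<close> is smooth.  Reflection treats the
  other endpoint.  If both exponents are fractional, a polynomial partition of unity that
  vanishes to high order at one endpoint or the other writes \<open>f\<close> as a sum of two functions
  with one singular endpoint each.
\<close>

section \<open>The quadrature rule as a linear functional\<close>

lemma cc_node_mem: "cc_node n j \<in> {-1..1}"
  by (simp add: cc_node_def)

lemma cc_error_cong:
  assumes "\<And>x. x \<in> {-1..1} \<Longrightarrow> f x = h x"
  shows "cc_error n f = cc_error n h"
proof -
  have "integral {-1..1} f = integral {-1..1} h"
    using assms by (rule Henstock_Kurzweil_Integration.integral_cong)
  moreover have "clenshaw_curtis n f = clenshaw_curtis n h"
    unfolding clenshaw_curtis_def using assms cc_node_mem by (intro sum.cong) auto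
  ultimately show ?thesis by (simp add: cc_error_def)
qed

lemma cc_error_add:
  assumes "continuous_on {-1..1} f" "continuous_on {-1..1} h"
  shows "cc_error n (\<lambda>x. f x + h x) = cc_error n f + cc_error n h"
proof -
  have "integral {-1..1} (\<lambda>x. f x + h x) = integral {-1..1} f + integral {-1..1} h"
    using assms by (intro Henstock_Kurzweil_Integration.integral_add integrable_continuous_interval)
  then show ?thesis
    by (simp add: cc_error_def clenshaw_curtis_def algebra_simps sum.distrib)
qed

lemma cc_error_cmult: "cc_error n (\<lambda>x. c * f x) = c * cc_error n f"
  by (simp add: cc_error_def clenshaw_curtis_def sum_distrib_left algebra_simps)

lemma cc_error_diff:
  assumes "continuous_on {-1..1} f" "continuous_on {-1..1} h"
  shows "cc_error n (\<lambda>x. f x - h x) = cc_error n f - cc_error n h"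
  using cc_error_add[of f "\<lambda>x. - 1 * h x" n] cc_error_cmult[of n "-1" h] assms
  by (simp add: continuous_on_minus)

lemma cc_error_sum:
  assumes "finite I" "\<And>i. i \<in> I \<Longrightarrow> continuous_on {-1..1} (f i)"
  shows "cc_error n (\<lambda>x. \<Sum>i\<in>I. f i x) = (\<Sum>i\<in>I. cc_error n (f i))"
  using assms
proof (induction I rule: finite_induct)
  case empty
  then show ?case by (simp add: cc_error_def clenshaw_curtis_def)
next
  case (insert i I)
  then show ?case
    by (subst sum.insert) (auto simp: cc_error_add continuous_on_sum)
qed

section \<open>Exactness for polynomials\<close>

lemma integral_eq_integral_cos:
  fixes f :: "real \<Rightarrow> real"
  assumes "continuous_on {-1..1} f"
  shows "((\<lambda>\<theta>. f (cos \<theta>) * sin \<theta>) has_integral integral {-1..1} f) {0..pi}"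
proof -
  define F where "F = (\<lambda>x. integral {-1..x} f)"
  have F: "(F has_real_derivative f x) (at x within {-1..1})" if "x \<in> {-1..1}" for x
    unfolding F_def using integral_has_real_derivative[OF assms] that by simp
  have "((\<lambda>\<theta>. - F (cos \<theta>)) has_vector_derivative f (cos \<theta>) * sin \<theta>) (at \<theta> within {0..pi})" for \<theta>
  proof -
    have "(F has_real_derivative f (cos \<theta>)) (at (cos \<theta>) within cos ` {0..pi})"
      by (rule DERIV_subset[OF F]) auto
    moreover have "(cos has_real_derivative - sin \<theta>) (at \<theta> within {0..pi})"
      by (auto intro!: derivative_eq_intros)
    ultimately have "(F \<circ> cos has_real_derivative f (cos \<theta>) * - sin \<theta>) (at \<theta> within {0..pi})"
      by (rule DERIV_image_chain)
    from DERIV_minus[OF this] show ?thesis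
      by (simp add: o_def has_real_derivative_iff_has_vector_derivative)
  qed
  then have "((\<lambda>\<theta>. f (cos \<theta>) * sin \<theta>) has_integral - F (cos pi) - - F (cos 0)) {0..pi}"
    by (intro fundamental_theorem_of_calculus) auto
  then show ?thesis by (simp add: F_def)
qed

lemma integral_cos_mult_sin:
  "((\<lambda>\<theta>. cos (real i * \<theta>) * sin \<theta>) has_integral (if even i then 2 / (1 - (real i)\<^sup>2) else 0)) {0..pi}"
proof (cases "i = 1")
  case True
  have "((\<lambda>\<theta>. cos \<theta> * sin \<theta>) has_integral (sin pi)\<^sup>2 / 2 - (sin 0)\<^sup>2 / 2) {0..pi}"
    by (intro fundamental_theorem_of_calculus)
       (auto intro!: derivative_eq_intros simp flip: has_real_derivative_iff_has_vector_derivative)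
  with True show ?thesis by simp
next
  case False
  define G where "G = (\<lambda>\<theta>. cos ((real i - 1) * \<theta>) / (2 * (real i - 1)) - cos ((real i + 1) * \<theta>) / (2 * (real i + 1)))"
  have ne: "real i - 1 \<noteq> 0" "real i + 1 \<noteq> 0" using False by auto
  have "(G has_real_derivative cos (real i * \<theta>) * sin \<theta>) (at \<theta> within {0..pi})" for \<theta>
  proof -
    have "(G has_real_derivative - sin ((real i - 1) * \<theta>) * (real i - 1) / (2 * (real i - 1))
           - - sin ((real i + 1) * \<theta>) * (real i + 1) / (2 * (real i + 1))) (at \<theta> within {0..pi})"
      unfolding G_def using ne by (auto intro!: derivative_eq_intros)
    also have "- sin ((real i - 1) * \<theta>) * (real i - 1) / (2 * (real i - 1))
           - - sin ((real i + 1) * \<theta>) * (real i + 1) / (2 * (real i + 1))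
         = (sin (real i * \<theta> + \<theta>) - sin (real i * \<theta> - \<theta>)) / 2"
    proof -
      have *: "- u * a / (2 * a) = - u / 2" if "a \<noteq> 0" for u a :: real using that by simp
      have "(real i - 1) * \<theta> = real i * \<theta> - \<theta>" "(real i + 1) * \<theta> = real i * \<theta> + \<theta>"
        by (auto simp: algebra_simps)
      then show ?thesis unfolding *[OF ne(1)] *[OF ne(2)] by simp
    qed
    also have "\<dots> = cos (real i * \<theta>) * sin \<theta>"
      by (simp add: sin_add sin_diff)
    finally show ?thesis .
  qed
  then have "((\<lambda>\<theta>. cos (real i * \<theta>) * sin \<theta>) has_integral G pi - G 0) {0..pi}"
    by (intro fundamental_theorem_of_calculus) (auto simp flip: has_real_derivative_iff_has_vector_derivative)
  also have "G pi - G 0 = (if even i then 2 / (1 - (real i)\<^sup>2) else 0)"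
  proof -
    have c: "cos ((real i - 1) * pi) = - ((-1) ^ i)" "cos ((real i + 1) * pi) = - ((-1) ^ i)"
      by (simp_all add: left_diff_distrib distrib_right cos_diff cos_add)
    have "G pi - G 0 = (1 + (-1) ^ i) / 2 * (1 / (real i + 1) - 1 / (real i - 1))"
      by (simp add: G_def c divide_simps) (simp add: algebra_simps)
    also have "1 / (real i + 1) - 1 / (real i - 1) = -2 / ((real i + 1) * (real i - 1))"
      using ne by (simp add: field_simps)
    also have "(real i + 1) * (real i - 1) = - (1 - (real i)\<^sup>2)"
      by (simp add: power2_eq_square algebra_simps)
    finally have "G pi - G 0 = (1 + (-1) ^ i) / 2 * (2 / (1 - (real i)\<^sup>2))"
      by (simp only: divide_minus_right minus_divide_left minus_minus)
    then show ?thesis by (cases "even i") simp_all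
  qed
  finally show ?thesis .
qed

text \<open>
  The halved end terms make this sum a composite trapezoidal sum.
\<close>
lemma sum_cc_delta:
  assumes "n \<ge> 1"
  shows "(\<Sum>j=0..n. cc_delta n j * g j) = (\<Sum>j<n. (g j + g (Suc j)) / 2)"
proof -
  have "(\<Sum>j=0..n. cc_delta n j * g j)
      = (\<Sum>j=0..n. g j - (if j = 0 then g j / 2 else 0) - (if j = n then g j / 2 else 0))"
    using assms by (intro sum.cong) (auto simp: cc_delta_def)
  also have "\<dots> = (\<Sum>j=0..n. g j) - g 0 / 2 - g n / 2"
    by (simp add: sum_subtractf)
  also have "(\<Sum>j=0..n. g j) - g 0 / 2 - g n / 2 = (\<Sum>j<n. (g j + g (Suc j)) / 2)"
    by (induction n) (auto simp: field_simps)
  finally show ?thesis .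
qed

text \<open>
  Discrete orthogonality of the cosines.  For \<open>x = m\<pi> / n\<close> the trapezoidal sum of \<open>cos (jx)\<close>
  telescopes after multiplication with \<open>2 sin (x / 2)\<close>, to \<open>sin (nx) cos (x / 2) = 0\<close>; the
  factor \<open>sin (x / 2)\<close> vanishes only when \<open>2n\<close> divides \<open>m\<close>.
\<close>
lemma sum_cc_delta_cos:
  assumes "n \<ge> 1" "\<bar>m\<bar> \<le> 2 * int n"
  shows "(\<Sum>j=0..n. cc_delta n j * cos (real j * (of_int m * pi / real n)))
       = (if m = 0 \<or> \<bar>m\<bar> = 2 * int n then real n else 0)"
proof (cases "m = 0 \<or> \<bar>m\<bar> = 2 * int n")
  case True
  then consider "m = 0" | "m = 2 * int n" | "m = - (2 * int n)" by linarith
  then have "cos (real j * (of_int m * pi / real n)) = 1" for j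
  proof cases
    case 2
    then have "real j * (of_int m * pi / real n) = 2 * pi * real j" using assms by simp
    then show ?thesis by (metis cos_int_2pin of_int_of_nat_eq)
  next
    case 3
    then have "real j * (of_int m * pi / real n) = - (2 * pi * real j)" using assms by simp
    then show ?thesis by (metis cos_minus cos_int_2pin of_int_of_nat_eq)
  qed auto
  then have "(\<Sum>j=0..n. cc_delta n j * cos (real j * (of_int m * pi / real n))) = (\<Sum>j=0..n. cc_delta n j * 1)"
    by (simp only:)
  also have "\<dots> = real n" by (subst sum_cc_delta[OF assms(1)]) simp
  finally show ?thesis using True by (simp only: if_True)
next
  case False
  define x where "x = of_int m * pi / real n"
  have *: "(\<Sum>j<k. (cos (real j * x) + cos (real (Suc j) * x)) / 2) * (2 * sin (x / 2)) = sin (real k * x) * cos (x / 2)" for k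
  proof (induction k)
    case (Suc k)
    define y where "y = real k * x + x / 2"
    have a: "real k * x = y - x / 2" "real (Suc k) * x = y + x / 2"
      by (auto simp: y_def algebra_simps)
    have step: "(cos (real k * x) + cos (real (Suc k) * x)) / 2 * (2 * sin (x / 2))
        = sin (real (Suc k) * x) * cos (x / 2) - sin (real k * x) * cos (x / 2)"
      unfolding a cos_add cos_diff sin_add sin_diff by (simp add: algebra_simps)
    show ?case 
      by (simp only: sum.lessThan_Suc distrib_right[of _ _ "2 * sin (x / 2)"] Suc.IH step add_diff_eq add_diff_cancel_left')
  qed simp
  have s: "sin (x / 2) \<noteq> 0"
  proof
    assume "sin (x / 2) = 0"
    then obtain i :: int where i: "x / 2 = of_int i * pi" by (auto simp: sin_zero_iff_int2)
    then have "of_int m = (of_int (2 * int n * i) :: real)"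
      using assms(1) by (simp add: x_def field_simps)
    then have m: "m = 2 * int n * i" by linarith
    show False
    proof (cases "\<bar>i\<bar> \<le> 1")
      case True
      then have "i = 0 \<or> i = 1 \<or> i = -1" by linarith
      with m False show False by auto
    next
      case i1: False
      have "2 * int n * 2 \<le> 2 * int n * \<bar>i\<bar>" using i1 by (intro mult_left_mono) auto
      then have "\<bar>m\<bar> \<ge> 4 * int n" using m by (simp add: abs_mult)
      with assms False show False by linarith
    qed
  qed
  have "real n * x = of_int m * pi" using assms(1) by (simp add: x_def)
  then have sin0: "sin (real n * x) = 0" by (auto simp: sin_zero_iff_int2)
  have "(\<Sum>j<n. (cos (real j * x) + cos (real (Suc j) * x)) / 2) * (2 * sin (x / 2)) = 0"
    unfolding * sin0 by simp
  moreover have "2 * sin (x / 2) \<noteq> 0" using s by simp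
  ultimately have "(\<Sum>j<n. (cos (real j * x) + cos (real (Suc j) * x)) / 2) = 0"
    unfolding mult_eq_0_iff by blast
  then show ?thesis
    unfolding x_def[symmetric] sum_cc_delta[OF assms(1), of "\<lambda>j. cos (real j * x)"] using False by (simp only: if_False)
qed

text \<open>
  In \<open>x = cos \<theta>\<close> this is exactness for the \<open>i\<close>-th Chebyshev polynomial: the value agrees with
  the integral \<open>integral_cos_mult_sin\<close>.  By orthogonality only the term \<open>2k = i\<close> of the weight
  survives, and \<open>cc_delta\<close> there compensates the doubled norm of the frequencies \<open>0\<close> and \<open>n\<close>.
\<close>
lemma clenshaw_curtis_cos:
  assumes n: "n \<ge> 1" and i: "i \<le> n"
  shows "(\<Sum>j=0..n. cc_weight n j * cos (real i * (real j * pi / real n)))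
       = (if even i then 2 / (1 - (real i)\<^sup>2) else 0)"
proof -
  have D: "(\<Sum>j=0..n. cc_delta n j * (cos (2 * real j * real k * pi / real n) * cos (real i * (real j * pi / real n))))
         = (if 2 * k = i then real n / (2 * cc_delta n i) else 0)" if k: "k \<le> n div 2" for k
  proof -
    have k2: "2 * k \<le> n" using k by auto
    have "cos (2 * real j * real k * pi / real n) * cos (real i * (real j * pi / real n))
        = (cos (real j * (of_int (2 * int k - int i) * pi / real n))
         + cos (real j * (of_int (2 * int k + int i) * pi / real n))) / 2" for j
      unfolding cos_times_cos by (simp add: algebra_simps add_divide_distrib diff_divide_distrib)
    then have "(\<Sum>j=0..n. cc_delta n j * (cos (2 * real j * real k * pi / real n) * cos (real i * (real j * pi / real n))))
      = ((\<Sum>j=0..n. cc_delta n j * cos (real j * (of_int (2 * int k - int i) * pi / real n)))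
       + (\<Sum>j=0..n. cc_delta n j * cos (real j * (of_int (2 * int k + int i) * pi / real n)))) / 2"
      by (simp add: sum_divide_distrib sum.distrib distrib_left add_divide_distrib)
    also have "\<dots> = (if 2 * k = i then real n / (2 * cc_delta n i) else 0)"
      using n i k2 by (subst (1 2) sum_cc_delta_cos) (auto simp: cc_delta_def)
    finally show ?thesis .
  qed
  have "(\<Sum>j=0..n. cc_weight n j * cos (real i * (real j * pi / real n)))
      = (\<Sum>j=0..n. \<Sum>k=0..n div 2. 4 / real n * (cc_delta n (2 * k) / (1 - 4 * (real k)\<^sup>2)) *
           (cc_delta n j * (cos (2 * real j * real k * pi / real n) * cos (real i * (real j * pi / real n)))))"
    by (simp add: cc_weight_def sum_distrib_left sum_distrib_right mult_ac)
  also have "\<dots> = (\<Sum>k=0..n div 2. 4 / real n * (cc_delta n (2 * k) / (1 - 4 * (real k)\<^sup>2)) *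
      (\<Sum>j=0..n. cc_delta n j * (cos (2 * real j * real k * pi / real n) * cos (real i * (real j * pi / real n)))))"
    by (subst sum.swap) (simp add: sum_distrib_left)
  also have "\<dots> = (\<Sum>k=0..n div 2. if 2 * k = i then 2 / (1 - (real i)\<^sup>2) else 0)"
  proof (intro sum.cong refl)
    fix k assume "k \<in> {0..n div 2}"
    then show "4 / real n * (cc_delta n (2 * k) / (1 - 4 * (real k)\<^sup>2)) *
      (\<Sum>j=0..n. cc_delta n j * (cos (2 * real j * real k * pi / real n) * cos (real i * (real j * pi / real n))))
      = (if 2 * k = i then 2 / (1 - (real i)\<^sup>2) else 0)"
      using n by (subst D) (auto simp: cc_delta_def power_mult_distrib)
  qed
  also have "\<dots> = (if even i then 2 / (1 - (real i)\<^sup>2) else 0)"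
  proof (cases "even i")
    case True
    then obtain l where l: "i = 2 * l" by auto
    with i have "l \<in> {0..n div 2}" by auto
    then show ?thesis using l by simp
  qed (auto intro!: sum.neutral)
  finally show ?thesis .
qed

text \<open>
  Monomials are combinations of Chebyshev polynomials of at most the same degree, which
  carries exactness over from the cosines to all polynomials of degree at most \<open>n\<close>.
\<close>
lemma cos_power_eq_sum_cos:
  "\<exists>c::nat \<Rightarrow> real. \<forall>\<theta>::real. cos \<theta> ^ k = (\<Sum>i\<le>k. c i * cos (real i * \<theta>))"
proof (induction k)
  case 0
  show ?case by (intro exI[of _ "\<lambda>_. 1"]) simp
next
  case (Suc k)
  then obtain c :: "nat \<Rightarrow> real" where c: "\<And>\<theta>. cos \<theta> ^ k = (\<Sum>i\<le>k. c i * cos (real i * \<theta>))" by blast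
  \<comment> \<open>\<open>cos \<theta> * cos (i\<theta>)\<close> is the mean of the frequencies \<open>i + 1\<close> and \<open>\<bar>i - 1\<bar>\<close>.\<close>
  define d where "d = (\<lambda>l. \<Sum>i\<le>k. (if l = Suc i then c i / 2 else 0) + (if l = (if i = 0 then 1 else i - 1) then c i / 2 else 0))"
  have "cos \<theta> ^ Suc k = (\<Sum>l\<le>Suc k. d l * cos (real l * \<theta>))" for \<theta>
  proof -
    have "(\<Sum>l\<le>Suc k. d l * cos (real l * \<theta>))
        = (\<Sum>l\<le>Suc k. \<Sum>i\<le>k. (if l = Suc i then c i / 2 * cos (real l * \<theta>) else 0)
              + (if l = (if i = 0 then 1 else i - 1) then c i / 2 * cos (real l * \<theta>) else 0))"
      unfolding d_def sum_distrib_right by (intro sum.cong refl) (auto simp: algebra_simps)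
    also have "\<dots> = (\<Sum>i\<le>k. \<Sum>l\<le>Suc k. (if l = Suc i then c i / 2 * cos (real l * \<theta>) else 0)
              + (if l = (if i = 0 then 1 else i - 1) then c i / 2 * cos (real l * \<theta>) else 0))"
      by (rule sum.swap)
    also have "\<dots> = (\<Sum>i\<le>k. cos \<theta> * (c i * cos (real i * \<theta>)))"
    proof (intro sum.cong refl)
      fix i assume i: "i \<in> {..k}"
      have "(\<Sum>l\<le>Suc k. (if l = Suc i then c i / 2 * cos (real l * \<theta>) else 0)
              + (if l = (if i = 0 then 1 else i - 1) then c i / 2 * cos (real l * \<theta>) else 0))
          = c i / 2 * cos (real (Suc i) * \<theta>) + c i / 2 * cos (real (if i = 0 then 1 else i - 1) * \<theta>)"
        using i by (subst sum.distrib, subst (1 2) sum.delta) (auto simp del: sum.atMost_Suc)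
      also have "cos (real (if i = 0 then 1 else i - 1) * \<theta>) = cos (real i * \<theta> - \<theta>)"
        by (cases i) (auto simp: algebra_simps)
      also have "real (Suc i) * \<theta> = real i * \<theta> + \<theta>" by (simp add: algebra_simps)
      finally show "(\<Sum>l\<le>Suc k. (if l = Suc i then c i / 2 * cos (real l * \<theta>) else 0)
              + (if l = (if i = 0 then 1 else i - 1) then c i / 2 * cos (real l * \<theta>) else 0))
          = cos \<theta> * (c i * cos (real i * \<theta>))"
        by (simp add: cos_add cos_diff algebra_simps)
    qed
    also have "\<dots> = cos \<theta> ^ Suc k" by (simp add: c sum_distrib_left)
    finally show ?thesis ..
  qed
  then show ?case by blast
qed

lemma cc_error_power:
  assumes "n \<ge> 1" "k \<le> n"
  shows "cc_error n (\<lambda>x. x ^ k) = 0"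
proof -
  obtain c :: "nat \<Rightarrow> real" where c: "\<And>\<theta>. cos \<theta> ^ k = (\<Sum>i\<le>k. c i * cos (real i * \<theta>))"
    using cos_power_eq_sum_cos by blast
  define e where "e = (\<lambda>i::nat. if even i then 2 / (1 - (real i)\<^sup>2) else 0)"
  have "((\<lambda>\<theta>. \<Sum>i\<le>k. c i * (cos (real i * \<theta>) * sin \<theta>)) has_integral (\<Sum>i\<le>k. c i * e i)) {0..pi}"
    unfolding e_def by (intro has_integral_sum has_integral_mult_right integral_cos_mult_sin) auto
  then have "((\<lambda>\<theta>. cos \<theta> ^ k * sin \<theta>) has_integral (\<Sum>i\<le>k. c i * e i)) {0..pi}"
    by (simp add: c sum_distrib_left sum_distrib_right mult_ac)
  moreover have "((\<lambda>\<theta>. cos \<theta> ^ k * sin \<theta>) has_integral integral {-1..1} (\<lambda>x. x ^ k)) {0..pi}"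
    by (rule integral_eq_integral_cos) (intro continuous_intros)
  ultimately have "integral {-1..1} (\<lambda>x::real. x ^ k) = (\<Sum>i\<le>k. c i * e i)"
    using has_integral_unique by blast
  moreover have "clenshaw_curtis n (\<lambda>x. x ^ k) = (\<Sum>i\<le>k. c i * e i)"
  proof -
    have "clenshaw_curtis n (\<lambda>x. x ^ k)
        = (\<Sum>j=0..n. \<Sum>i\<le>k. c i * (cc_weight n j * cos (real i * (real j * pi / real n))))"
      by (simp add: clenshaw_curtis_def cc_node_def c sum_distrib_left mult_ac)
    also have "\<dots> = (\<Sum>i\<le>k. c i * (\<Sum>j=0..n. cc_weight n j * cos (real i * (real j * pi / real n))))"
      by (subst sum.swap) (simp add: sum_distrib_left)
    also have "\<dots> = (\<Sum>i\<le>k. c i * e i)"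
      using assms by (intro sum.cong refl) (simp add: clenshaw_curtis_cos e_def del: times_divide_eq_right)
    finally show ?thesis .
  qed
  ultimately show ?thesis by (simp add: cc_error_def)
qed

lemma cc_error_poly:
  assumes "n \<ge> 1" "degree p \<le> n"
  shows "cc_error n (poly p) = 0"
proof -
  have "cc_error n (poly p) = cc_error n (\<lambda>x. \<Sum>i\<le>degree p. coeff p i * x ^ i)"
    by (rule cc_error_cong) (simp add: poly_altdef)
  also have "\<dots> = (\<Sum>i\<le>degree p. coeff p i * cc_error n (\<lambda>x. x ^ i))"
    by (subst cc_error_sum) (auto simp: cc_error_cmult intro!: continuous_intros)
  also have "\<dots> = 0" using assms by (simp add: cc_error_power)
  finally show ?thesis .
qed

section \<open>Stability\<close>

text \<open>
  Crude: all terms of the cosine sum are replaced by \<open>1\<close>.  The loss of one power of \<open>n\<close> in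
  the sum of the weights is harmless, as the bound is only applied to functions
  that are approximated by polynomials to an order of choice.
\<close>
lemma abs_cc_weight_le:
  assumes "n \<ge> 1"
  shows "\<bar>cc_weight n j\<bar> \<le> 6"
proof -
  have "\<bar>cc_delta n (2 * k) / (1 - 4 * (real k)\<^sup>2) * cos (2 * real j * real k * pi / real n)\<bar> \<le> 1" for k
  proof -
    have "\<bar>1 - 4 * (real k)\<^sup>2\<bar> \<ge> 1"
    proof (cases "k = 0")
      case False
      then have "(real k)\<^sup>2 \<ge> 1" by simp
      then show ?thesis by linarith
    qed simp
    then have "\<bar>cc_delta n (2 * k)\<bar> / \<bar>1 - 4 * (real k)\<^sup>2\<bar> \<le> 1 / 1"
      by (intro frac_le) (auto simp: cc_delta_def)
    then have "\<bar>cc_delta n (2 * k) / (1 - 4 * (real k)\<^sup>2)\<bar> * \<bar>cos (2 * real j * real k * pi / real n)\<bar> \<le> 1 * 1"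
      by (intro mult_mono) (auto simp: abs_cos_le_one)
    then show ?thesis by (simp only: abs_mult)
  qed
  then have "\<bar>\<Sum>k = 0..n div 2. cc_delta n (2 * k) / (1 - 4 * (real k)\<^sup>2) * cos (2 * real j * real k * pi / real n)\<bar>
      \<le> (\<Sum>k = 0..n div 2. 1)"
    by (intro order_trans[OF sum_abs] sum_mono)
  also have "\<dots> \<le> real n / 2 + 1" by simp
  finally have s: "\<bar>\<Sum>k = 0..n div 2. cc_delta n (2 * k) / (1 - 4 * (real k)\<^sup>2) * cos (2 * real j * real k * pi / real n)\<bar>
      \<le> real n / 2 + 1" .
  have "\<bar>cc_weight n j\<bar> \<le> 4 / real n * (real n / 2 + 1)"
    unfolding cc_weight_def abs_mult
    by (intro mult_mono s) (use assms in \<open>auto simp: cc_delta_def divide_right_mono\<close>)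
  also have "\<dots> \<le> 6" using assms by (simp add: field_simps)
  finally show ?thesis .
qed

lemma abs_cc_error_le:
  assumes "n \<ge> 1" "continuous_on {-1..1} f" "\<And>x. x \<in> {-1..1} \<Longrightarrow> \<bar>f x\<bar> \<le> e"
  shows "\<bar>cc_error n f\<bar> \<le> 14 * real n * e"
proof -
  have e: "e \<ge> 0" using assms(3)[of 0] by auto
  have "norm (integral {-1..1} f) \<le> e * (1 - (-1))"
    using assms by (intro integral_bound) auto
  moreover have "\<bar>clenshaw_curtis n f\<bar> \<le> (\<Sum>j=0..n. 6 * e)"
    unfolding clenshaw_curtis_def
    by (intro order_trans[OF sum_abs] sum_mono)
       (auto simp: abs_mult intro!: mult_mono abs_cc_weight_le assms cc_node_mem simp del: atLeastAtMost_iff)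
  \<comment> \<open>\<open>2 * e\<close> bounds the integral, and \<open>6 * e\<close> the contribution of each node\<close>
  ultimately have "\<bar>cc_error n f\<bar> \<le> 2 * e + 6 * e * (real n + 1)"
    by (simp add: cc_error_def algebra_simps)
  also have "\<dots> = 8 * e * 1 + 6 * e * real n" by (simp add: algebra_simps)
  also have "\<dots> \<le> 8 * e * real n + 6 * e * real n"
    using assms(1) e by (intro add_right_mono mult_left_mono) auto
  finally show ?thesis by (simp add: algebra_simps)
qed

lemma cc_error_reflect: "cc_error n (\<lambda>x. f (- x)) = cc_error n f" if n: "n \<ge> 1"
proof -
  have I: "integral {-1..1} (\<lambda>x. f (- x)) = integral {-1..1} f"
    using Henstock_Kurzweil_Integration.integral_reflect_real[of 1 "-1" f] by simp
  have w: "cc_weight n (n - j) = cc_weight n j" if "j \<le> n" for j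
  proof -
    have "cos (2 * real (n - j) * real k * pi / real n) = cos (2 * real j * real k * pi / real n)" for k
    proof -
      have "2 * real (n - j) * real k * pi / real n = 2 * pi * of_int (int k) - 2 * real j * real k * pi / real n"
        using that n by (simp add: of_nat_diff field_simps)
      then show ?thesis by (simp only: cos_diff cos_int_2pin sin_int_2pin mult_1 mult_zero_left add_0_right)
    qed
    moreover have "cc_delta n (n - j) = cc_delta n j" using that by (auto simp: cc_delta_def)
    ultimately show ?thesis by (simp add: cc_weight_def)
  qed
  have x: "cc_node n (n - j) = - cc_node n j" if "j \<le> n" for j
  proof -
    have "real (n - j) * pi / real n = pi - real j * pi / real n"
      using that n by (simp add: of_nat_diff field_simps)
    then show ?thesis by (simp add: cc_node_def)
  qed
  have "clenshaw_curtis n f = (\<Sum>j=0..n. cc_weight n (n - j) * f (cc_node n (n - j)))"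
    unfolding clenshaw_curtis_def using sum.nat_diff_reindex[of "\<lambda>j. cc_weight n j * f (cc_node n j)" "Suc n"]
    by (simp add: atLeast0AtMost lessThan_Suc_atMost)
  also have "\<dots> = clenshaw_curtis n (\<lambda>x. f (- x))"
    unfolding clenshaw_curtis_def by (intro sum.cong refl) (simp add: w x)
  finally show ?thesis by (simp add: cc_error_def I)
qed

section \<open>The error for the Cauchy kernel\<close>

text \<open>
  Dividing \<open>p\<close> by \<open>t - x\<close> leaves the remainder \<open>p(t)\<close> and a quotient of degree at most \<open>n\<close>, which the
  rule integrates exactly.  It is used for two \<open>p\<close>: the node polynomial, and powers of \<open>1 - x\<close>.
\<close>
lemma cc_error_poly_div:
  assumes n: "n \<ge> 1" and d: "degree p \<le> Suc n" and t: "t > 1"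
  shows "cc_error n (\<lambda>x. poly p x / (t - x)) = poly p t * cc_error n (\<lambda>x. 1 / (t - x))"
proof -
  define q where "q = synthetic_div p t"
  have p: "poly p x = (x - t) * poly q x + poly p t" for x
  proof -
    have "poly ([:-t, 1:] * q + [:poly p t:]) x = poly p x"
      unfolding q_def by (simp only: synthetic_div_correct')
    then show ?thesis by (simp add: algebra_simps)
  qed
  have q: "cc_error n (poly q) = 0"
    using n d by (intro cc_error_poly) (auto simp: q_def degree_synthetic_div)
  have "cc_error n (\<lambda>x. poly p x / (t - x)) = cc_error n (\<lambda>x. poly p t * (1 / (t - x)) - poly q x)"
  proof (rule cc_error_cong)
    fix x :: real assume "x \<in> {-1..1}"
    then have "t - x \<noteq> 0" using t by auto
    then show "poly p x / (t - x) = poly p t * (1 / (t - x)) - poly q x"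
      unfolding p[of x] by (simp add: field_simps)
  qed
  also have "\<dots> = cc_error n (\<lambda>x. poly p t * (1 / (t - x))) - cc_error n (poly q)"
    using t by (intro cc_error_diff continuous_intros) auto
  finally show ?thesis by (simp only: q cc_error_cmult diff_zero)
qed

text \<open>
  The Chebyshev polynomials of the second kind, shifted in index: they satisfy
  \<open>U\<^sub>n(cos \<theta>) sin \<theta> = sin (n\<theta>)\<close>.
\<close>
fun cheb_U :: "nat \<Rightarrow> real poly" where
  "cheb_U 0 = 0"
| "cheb_U (Suc 0) = 1"
| "cheb_U (Suc (Suc n)) = [:0, 2:] * cheb_U (Suc n) - cheb_U n"

text \<open>
  Up to a constant factor, the monic polynomial whose zeros are the nodes.
\<close>
definition node_poly :: "nat \<Rightarrow> real poly" where
  "node_poly n = [:1, 0, -1:] * cheb_U n"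

lemma degree_cheb_U: "degree (cheb_U n) \<le> n - 1"
proof (induction n rule: cheb_U.induct)
  case (3 n)
  have "degree ([:0, 2:] * cheb_U (Suc n)) \<le> 1 + n"
    using 3(1) by (intro order_trans[OF degree_mult_le] add_mono) auto
  moreover have "degree (cheb_U n) \<le> 1 + n" using 3(2) by simp
  ultimately show ?case by (simp add: degree_diff_le)
qed auto

lemma degree_node_poly: "degree (node_poly n) \<le> Suc n"
proof (cases n)
  case (Suc k)
  have "degree (node_poly n) \<le> 2 + (n - 1)"
    unfolding node_poly_def using degree_cheb_U[of n]
    by (intro order_trans[OF degree_mult_le] add_mono) auto
  with Suc show ?thesis by simp
qed (simp add: node_poly_def)

lemma cheb_U_cos: "poly (cheb_U n) (cos \<theta>) * sin \<theta> = sin (real n * \<theta>)"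
proof (induction n rule: cheb_U.induct)
  case (3 n)
  have "poly (cheb_U (Suc (Suc n))) (cos \<theta>) * sin \<theta>
      = 2 * cos \<theta> * (poly (cheb_U (Suc n)) (cos \<theta>) * sin \<theta>) - poly (cheb_U n) (cos \<theta>) * sin \<theta>"
    by (simp add: algebra_simps)
  also have "\<dots> = 2 * cos \<theta> * sin (real (Suc n) * \<theta>) - sin (real n * \<theta>)"
    unfolding 3 ..
  also have "real n * \<theta> = real (Suc n) * \<theta> - \<theta>" by (simp add: algebra_simps)
  also have "2 * cos \<theta> * sin (real (Suc n) * \<theta>) - sin (real (Suc n) * \<theta> - \<theta>) = sin (real (Suc n) * \<theta> + \<theta>)"
    unfolding sin_add sin_diff by simp
  also have "real (Suc n) * \<theta> + \<theta> = real (Suc (Suc n)) * \<theta>" by (simp add: algebra_simps)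
  finally show ?case .
qed auto

lemma cheb_U_cosh: "poly (cheb_U n) (cosh u) * sinh u = sinh (real n * u)"
proof (induction n rule: cheb_U.induct)
  case (3 n)
  have "poly (cheb_U (Suc (Suc n))) (cosh u) * sinh u
      = 2 * cosh u * (poly (cheb_U (Suc n)) (cosh u) * sinh u) - poly (cheb_U n) (cosh u) * sinh u"
    by (simp add: algebra_simps)
  also have "\<dots> = 2 * cosh u * sinh (real (Suc n) * u) - sinh (real n * u)"
    unfolding 3 ..
  also have "real n * u = real (Suc n) * u - u" by (simp add: algebra_simps)
  also have "2 * cosh u * sinh (real (Suc n) * u) - sinh (real (Suc n) * u - u) = sinh (real (Suc n) * u + u)"
    unfolding sinh_add sinh_diff by simp
  also have "real (Suc n) * u + u = real (Suc (Suc n)) * u" by (simp add: algebra_simps)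
  finally show ?case .
qed auto

lemma node_poly_cos: "poly (node_poly n) (cos \<theta>) = sin \<theta> * sin (real n * \<theta>)"
proof -
  have "poly (node_poly n) (cos \<theta>) = (1 - (cos \<theta>)\<^sup>2) * poly (cheb_U n) (cos \<theta>)"
    by (simp add: node_poly_def power2_eq_square algebra_simps)
  also have "\<dots> = sin \<theta> * (poly (cheb_U n) (cos \<theta>) * sin \<theta>)"
    unfolding sin_squared_eq[symmetric] by (simp add: power2_eq_square)
  finally show ?thesis by (simp only: cheb_U_cos)
qed

lemma node_poly_cosh: "poly (node_poly n) (cosh u) = - (sinh u * sinh (real n * u))"
proof -
  have "poly (node_poly n) (cosh u) = (1 - (cosh u)\<^sup>2) * poly (cheb_U n) (cosh u)"
    by (simp add: node_poly_def power2_eq_square algebra_simps)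
  also have "\<dots> = - (sinh u * (poly (cheb_U n) (cosh u) * sinh u))"
    unfolding cosh_square_eq by (simp add: power2_eq_square)
  finally show ?thesis by (simp only: cheb_U_cosh)
qed

lemma node_poly_node: "n \<ge> 1 \<Longrightarrow> poly (node_poly n) (cc_node n j) = 0"
  unfolding cc_node_def node_poly_cos by simp

text \<open>
  For \<open>p = node_poly n\<close> in \<open>cc_error_poly_div\<close> the quadrature sum is zero, so the error on the left
  hand side is just an integral.
\<close>
lemma node_poly_mult_cc_error_kernel:
  assumes "n \<ge> 1" "t > 1"
  shows "poly (node_poly n) t * cc_error n (\<lambda>x. 1 / (t - x))
       = integral {-1..1} (\<lambda>x. poly (node_poly n) x / (t - x))"
proof -
  have "clenshaw_curtis n (\<lambda>x. poly (node_poly n) x / (t - x)) = 0"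
    using assms by (simp add: clenshaw_curtis_def node_poly_node)
  then show ?thesis
    using cc_error_poly_div[OF assms(1) degree_node_poly assms(2)] by (simp add: cc_error_def)
qed

text \<open>
  In \<open>x = cos \<theta>\<close> the integrand becomes \<open>sin (n\<theta>) \<psi>(\<theta>)\<close> with \<open>\<psi>(\<theta>) = sin\<^sup>2 \<theta> / (t - cos \<theta>)\<close>.
  Although \<open>\<psi>\<close> changes rapidly near \<open>\<theta> = 0\<close> when \<open>t\<close> is close to \<open>1\<close>, its variation is bounded
  uniformly in \<open>t\<close>; one integration by parts therefore gains the factor \<open>1 / n\<close>.
\<close>
lemma abs_integral_node_poly_kernel_le:
  assumes n: "n \<ge> 1" and t: "t > 1"
  shows "\<bar>integral {-1..1} (\<lambda>x. poly (node_poly n) x / (t - x))\<bar> \<le> 4 / real n"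
proof -
  define \<psi> where "\<psi> = (\<lambda>\<theta>. t + cos \<theta> - (t\<^sup>2 - 1) / (t - cos \<theta>))"
  define \<psi>' where "\<psi>' = (\<lambda>\<theta>. (t\<^sup>2 - 1) * sin \<theta> / (t - cos \<theta>)\<^sup>2 - sin \<theta>)"
  define I where "I = integral {-1..1} (\<lambda>x. poly (node_poly n) x / (t - x))"
  have pos: "t - cos \<theta> > 0" for \<theta> using t cos_le_one[of \<theta>] by linarith
  have t2: "t\<^sup>2 - 1 > 0" using t by (simp add: one_less_power)
  have \<psi>: "\<psi> \<theta> = (sin \<theta>)\<^sup>2 / (t - cos \<theta>)" for \<theta>
    using pos[of \<theta>] unfolding \<psi>_def sin_squared_eq by (simp add: field_simps power2_eq_square)
  have d\<psi>: "(\<psi> has_real_derivative \<psi>' \<theta>) (at \<theta> within S)" for \<theta> S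
    unfolding \<psi>_def \<psi>'_def using pos[of \<theta>]
    by (auto intro!: derivative_eq_intros simp: power2_eq_square)
  have I: "((\<lambda>\<theta>. sin (real n * \<theta>) * \<psi> \<theta>) has_integral I) {0..pi}"
  proof -
    have "((\<lambda>\<theta>. poly (node_poly n) (cos \<theta>) / (t - cos \<theta>) * sin \<theta>) has_integral I) {0..pi}"
      unfolding I_def using t by (intro integral_eq_integral_cos continuous_intros) auto
    moreover have "poly (node_poly n) (cos \<theta>) / (t - cos \<theta>) * sin \<theta> = sin (real n * \<theta>) * \<psi> \<theta>" for \<theta>
      unfolding node_poly_cos \<psi> by (simp add: power2_eq_square)
    ultimately show ?thesis by simp
  qed
  \<comment> \<open>Integration by parts; \<open>\<psi>\<close> vanishes at both ends, and its variation is estimated in \<open>V\<close>.\<close>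
  have parts: "((\<lambda>\<theta>. sin (real n * \<theta>) * \<psi> \<theta> - cos (real n * \<theta>) / real n * \<psi>' \<theta>) has_integral
      - (cos (real n * pi) / real n) * \<psi> pi - (- (cos (real n * 0) / real n) * \<psi> 0)) {0..pi}"
  proof (intro fundamental_theorem_of_calculus)
    fix \<theta> assume "\<theta> \<in> {0..pi}"
    show "((\<lambda>\<theta>. - (cos (real n * \<theta>) / real n) * \<psi> \<theta>) has_vector_derivative
            sin (real n * \<theta>) * \<psi> \<theta> - cos (real n * \<theta>) / real n * \<psi>' \<theta>) (at \<theta> within {0..pi})"
      unfolding has_real_derivative_iff_has_vector_derivative[symmetric] using n
      by (auto intro!: derivative_eq_intros d\<psi> simp: field_simps)
  qed simp
  have ends: "\<psi> 0 = 0" "\<psi> pi = 0" by (simp_all add: \<psi>)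
  have J: "((\<lambda>\<theta>. cos (real n * \<theta>) / real n * \<psi>' \<theta>) has_integral I) {0..pi}"
    using has_integral_diff[OF I parts] by (simp add: ends)
  \<comment> \<open>a primitive of the majorant of \<open>\<bar>\<psi>'\<bar>\<close> that adds the absolute values of its two terms\<close>
  have V: "((\<lambda>\<theta>. ((t\<^sup>2 - 1) * sin \<theta> / (t - cos \<theta>)\<^sup>2 + sin \<theta>) / real n) has_integral
      (- cos pi - (t\<^sup>2 - 1) / (t - cos pi)) / real n - (- cos 0 - (t\<^sup>2 - 1) / (t - cos 0)) / real n) {0..pi}"
  proof (intro fundamental_theorem_of_calculus)
    fix \<theta> assume "\<theta> \<in> {0..pi}"
    show "((\<lambda>\<theta>. (- cos \<theta> - (t\<^sup>2 - 1) / (t - cos \<theta>)) / real n) has_vector_derivative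
            ((t\<^sup>2 - 1) * sin \<theta> / (t - cos \<theta>)\<^sup>2 + sin \<theta>) / real n) (at \<theta> within {0..pi})"
      unfolding has_real_derivative_iff_has_vector_derivative[symmetric] using n pos[of \<theta>]
      by (auto intro!: derivative_eq_intros simp: power2_eq_square)
  qed simp
  have "(- cos pi - (t\<^sup>2 - 1) / (t - cos pi)) / real n - (- cos 0 - (t\<^sup>2 - 1) / (t - cos 0)) / real n = 4 / real n"
  proof -
    have "t\<^sup>2 - 1 = (t - 1) * (t + 1)" by (simp add: power2_eq_square algebra_simps)
    then have "(t\<^sup>2 - 1) / (t + 1) = t - 1" "(t\<^sup>2 - 1) / (t - 1) = t + 1" using t by auto
    then show ?thesis by (simp add: diff_divide_distrib add_divide_distrib)
  qed
  with V have V4: "((\<lambda>\<theta>. ((t\<^sup>2 - 1) * sin \<theta> / (t - cos \<theta>)\<^sup>2 + sin \<theta>) / real n) has_integral 4 / real n) {0..pi}"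
    by simp
  have "norm (integral {0..pi} (\<lambda>\<theta>. cos (real n * \<theta>) / real n * \<psi>' \<theta>))
      \<le> integral {0..pi} (\<lambda>\<theta>. ((t\<^sup>2 - 1) * sin \<theta> / (t - cos \<theta>)\<^sup>2 + sin \<theta>) / real n)"
  proof (rule integral_norm_bound_integral)
    fix \<theta> assume "\<theta> \<in> {0..pi}"
    then have s: "sin \<theta> \<ge> 0" by (simp add: sin_ge_zero)
    then have "\<bar>\<psi>' \<theta>\<bar> \<le> (t\<^sup>2 - 1) * sin \<theta> / (t - cos \<theta>)\<^sup>2 + sin \<theta>"
      using t2 unfolding \<psi>'_def by (intro order_trans[OF abs_triangle_ineq4]) auto
    moreover have "\<bar>cos (real n * \<theta>)\<bar> / real n \<le> 1 / real n"
      by (intro divide_right_mono) auto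
    ultimately have "\<bar>cos (real n * \<theta>)\<bar> / real n * \<bar>\<psi>' \<theta>\<bar>
        \<le> 1 / real n * ((t\<^sup>2 - 1) * sin \<theta> / (t - cos \<theta>)\<^sup>2 + sin \<theta>)"
      by (intro mult_mono) auto
    then show "norm (cos (real n * \<theta>) / real n * \<psi>' \<theta>) \<le> ((t\<^sup>2 - 1) * sin \<theta> / (t - cos \<theta>)\<^sup>2 + sin \<theta>) / real n"
      by (simp add: abs_mult)
  qed (use J V4 in \<open>auto simp: has_integral_integrable\<close>)
  then show ?thesis
    unfolding integral_unique[OF J] integral_unique[OF V4] by (simp only: I_def real_norm_def)
qed

lemma sinh_of_nat_mult_ge:
  assumes "u \<ge> (0::real)"
  shows "real n * sinh u \<le> sinh (real n * u)"
proof (induction n)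
  case (Suc n)
  have "real (Suc n) * sinh u = real n * sinh u * 1 + 1 * sinh u" by (simp add: algebra_simps)
  also have "\<dots> \<le> sinh (real n * u) * cosh u + cosh (real n * u) * sinh u"
    using assms Suc by (intro add_mono mult_mono) (auto simp: cosh_real_ge_1)
  also have "\<dots> = sinh (real (Suc n) * u)" by (simp add: sinh_add algebra_simps)
  finally show ?case .
qed simp

lemma sinh_of_nat_mult_ge_power:
  assumes "u \<ge> (0::real)"
  shows "sinh u ^ Suc n \<le> sinh (real (Suc n) * u)"
proof (induction n)
  case (Suc n)
  have "sinh u ^ Suc (Suc n) \<le> sinh u * sinh (real (Suc n) * u)"
    using Suc assms by (auto intro: mult_left_mono)
  also have "\<dots> \<le> cosh u * sinh (real (Suc n) * u)"
    using assms sinh_le_cosh_real[of u] by (intro mult_right_mono) auto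
  also have "\<dots> \<le> cosh u * sinh (real (Suc n) * u) + sinh u * cosh (real (Suc n) * u)"
    using assms by simp
  also have "\<dots> = sinh (real (Suc (Suc n)) * u)"
    using sinh_add[of "real (Suc n) * u" u] by (simp add: algebra_simps)
  finally show ?case .
qed simp

text \<open>
  With \<open>1 + v = cosh u\<close>, \<open>q = 2r - 1\<close> and \<open>p = n div q\<close>, superadditivity of \<open>sinh\<close> gives
  \<open>sinh (nu) \<ge> sinh (pu) ^ q \<ge> (p sinh u) ^ q\<close>, and \<open>sinh\<^sup>2 u \<ge> v\<close>.
\<close>
lemma abs_node_poly_ge:
  assumes v: "v > 0" and r: "r \<ge> 1"
  shows "real (n div (2 * r - 1)) ^ (2 * r - 1) * v ^ r \<le> \<bar>poly (node_poly n) (1 + v)\<bar>"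
proof -
  define u where "u = arcosh (1 + v)"
  have u: "cosh u = 1 + v" "u \<ge> 0" using v by (auto simp: u_def)
  define q where "q = 2 * r - 1"
  define p where "p = n div q"
  obtain q' where q': "q = Suc q'" using r by (cases q) (auto simp: q_def)
  have qr: "Suc q = 2 * r" using r by (simp add: q_def)
  have "v \<le> (sinh u)\<^sup>2"
  proof -
    have "(sinh u)\<^sup>2 = v * v + v * 2"
      using cosh_square_eq[of u] u(1) by (simp add: power2_eq_square algebra_simps)
    moreover have "v * v > 0" using v by simp
    ultimately show ?thesis using v by linarith
  qed
  then have "v ^ r \<le> sinh u ^ Suc q"
    unfolding qr power_mult using v by (intro power_mono) auto
  then have "real p ^ q * v ^ r \<le> real p ^ q * sinh u ^ Suc q"
    by (intro mult_left_mono) auto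
  also have "\<dots> = sinh u * (real p * sinh u) ^ q" by (simp add: power_mult_distrib)
  also have "\<dots> \<le> sinh u * sinh (real p * u) ^ q"
    using u by (intro mult_left_mono power_mono sinh_of_nat_mult_ge) auto
  also have "\<dots> \<le> sinh u * sinh (real q * (real p * u))"
    unfolding q' using u by (intro mult_left_mono sinh_of_nat_mult_ge_power) auto
  also have "\<dots> \<le> sinh u * sinh (real n * u)"
  proof (intro mult_left_mono)
    have "q * p \<le> n" by (simp add: p_def)
    then have "real q * real p \<le> real n" by (metis of_nat_le_iff of_nat_mult)
    then have "real q * (real p * u) \<le> real n * u"
      using u by (simp add: mult_right_mono flip: mult.assoc)
    then show "sinh (real q * (real p * u)) \<le> sinh (real n * u)" by simp
  qed (use u in auto)
  also have "\<dots> = \<bar>poly (node_poly n) (1 + v)\<bar>"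
    unfolding u(1)[symmetric] node_poly_cosh using u by (simp add: abs_mult)
  finally show ?thesis by (simp add: p_def q_def)
qed

text \<open>
  The bound decays like \<open>z ^ (-r)\<close> in \<open>z = n\<^sup>2 v\<close>.  The choice of \<open>r\<close> is left open because
  integrating against \<open>v powr \<gamma>\<close> requires \<open>r = 1\<close> for \<open>z \<le> 1\<close>, and a large \<open>r\<close> for \<open>z > 1\<close>.
\<close>
lemma abs_cc_error_kernel_le:
  assumes v: "v > 0" and r: "r \<ge> 1" and n: "n \<ge> 2 * r - 1"
  shows "\<bar>cc_error n (\<lambda>x. 1 / (1 + v - x))\<bar>
       \<le> 4 * (4 * real r) ^ (2 * r - 1) / ((real n)\<^sup>2 * v) ^ r"
proof -
  define q where "q = 2 * r - 1"
  define W where "W = \<bar>poly (node_poly n) (1 + v)\<bar>"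
  have q: "q \<ge> 1" "Suc q = 2 * r" using r by (auto simp: q_def)
  have n1: "n \<ge> 1" using n r by linarith
  have "real n / (4 * real r) \<le> real (n div q)"
  proof -
    \<comment> \<open>as \<open>q \<le> n\<close>, the integer part of \<open>n / q\<close> is at least half of \<open>n / q\<close>\<close>
    have "n < q * (n div q) + q" using q by (metis add_strict_left_mono mod_less_divisor mult_div_mod_eq less_le_trans zero_less_one)
    also have "\<dots> \<le> q * (n div q) + q * (n div q)"
      using n q by (simp add: q_def[symmetric] div_greater_zero_iff Suc_le_eq)
    also have "\<dots> \<le> 4 * r * (n div q)"
      using q by (simp flip: distrib_right)
    finally have "real n \<le> real (4 * r * (n div q))" by linarith
    then show ?thesis using r by (simp add: field_simps)
  qed
  then have "(real n / (4 * real r)) ^ q * v ^ r \<le> real (n div q) ^ q * v ^ r"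
    using v by (intro mult_right_mono power_mono) auto
  also have "\<dots> \<le> W" unfolding W_def q_def by (rule abs_node_poly_ge[OF v r])
  finally have W: "(real n / (4 * real r)) ^ q * v ^ r \<le> W" .
  have pos: "(real n / (4 * real r)) ^ q * v ^ r > 0" using n1 r v by simp
  have "W * \<bar>cc_error n (\<lambda>x. 1 / (1 + v - x))\<bar> \<le> 4 / real n"
    using node_poly_mult_cc_error_kernel[OF n1, of "1 + v"] abs_integral_node_poly_kernel_le[OF n1, of "1 + v"] v
    by (simp add: W_def flip: abs_mult)
  then have "\<bar>cc_error n (\<lambda>x. 1 / (1 + v - x))\<bar> \<le> 4 / real n / W"
    using W pos by (subst pos_le_divide_eq) (auto simp: mult.commute)
  also have "\<dots> \<le> 4 / real n / ((real n / (4 * real r)) ^ q * v ^ r)"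
    using W pos by (intro divide_left_mono) auto
  also have "\<dots> = 4 * (4 * real r) ^ q / (real n ^ Suc q * v ^ r)"
    using n1 r v by (simp add: power_divide field_simps)
  also have "real n ^ Suc q * v ^ r = ((real n)\<^sup>2 * v) ^ r"
    by (simp add: q(2) power_mult power_mult_distrib del: power_Suc)
  finally show ?thesis by (simp add: q_def)
qed

section \<open>The error for fractional powers\<close>

text \<open>
  The integrable majorants below all have this form: one power near \<open>0\<close>, another near infinity.
\<close>
definition two_power :: "real \<Rightarrow> real \<Rightarrow> real \<Rightarrow> real" where
  "two_power p q z = (if z \<le> 0 then 0 else if z \<le> 1 then z powr p else z powr q)"

lemma two_power_nonneg: "two_power p q z \<ge> 0"
  by (simp add: two_power_def)

lemma borel_measurable_two_power [measurable]: "two_power p q \<in> borel_measurable borel"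
  unfolding two_power_def[abs_def] by measurable

lemma integrable_two_power:
  assumes "p > -1" "q < -1"
  shows "integrable lborel (two_power p q)"
proof -
  have I: "integrable lborel (\<lambda>z. indicator S z *\<^sub>R (z powr a))"
    if "(\<lambda>z::real. z powr a) integrable_on S" "S \<in> sets borel" for S a
  proof -
    have "(\<lambda>z::real. z powr a) absolutely_integrable_on S"
      using that(1) by (intro nonnegative_absolutely_integrable_1) auto
    then have "integrable lebesgue (\<lambda>z. indicator S z *\<^sub>R (z powr a))"
      by (simp add: set_integrable_def)
    moreover have "(\<lambda>z. indicator S z *\<^sub>R (z powr a)) \<in> borel_measurable lborel"
      using that(2) by measurable
    ultimately show ?thesis by (simp add: integrable_completion)
  qed
  have 1: "integrable lborel (\<lambda>z. indicator {0..1} z *\<^sub>R (z powr p))"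
    using has_integral_powr_from_0[of p 1] assms by (intro I) (auto simp: has_integral_integrable)
  have 2: "integrable lborel (\<lambda>z. indicator {1..} z *\<^sub>R (z powr q))"
    using has_integral_powr_to_inf[of q 1] assms by (intro I) (auto simp: has_integral_integrable)
  show ?thesis
  proof (rule Bochner_Integration.integrable_bound[OF Bochner_Integration.integrable_add[OF 1 2]])
    show "AE z in lborel. norm (two_power p q z)
        \<le> norm (indicator {0..1} z *\<^sub>R (z powr p) + indicator {1..} z *\<^sub>R (z powr q))"
      by (intro AE_I2) (auto simp: two_power_def indicator_def)
  qed measurable
qed

text \<open>
  The integrand of Euler's integral for \<open>\<pi> / sin (\<pi>\<sigma>)\<close>.  Of the value of this integral, the constant
  \<open>stieltjes_const\<close> below, only positivity matters.
\<close>
definition stieltjes :: "real \<Rightarrow> real \<Rightarrow> real" where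
  "stieltjes \<sigma> w = (if w > 0 then w powr (\<sigma> - 1) / (1 + w) else 0)"

lemma borel_measurable_stieltjes [measurable]: "stieltjes \<sigma> \<in> borel_measurable borel"
  unfolding stieltjes_def[abs_def] by measurable

lemma integrable_stieltjes:
  assumes "0 < \<sigma>" "\<sigma> < 1"
  shows "integrable lborel (stieltjes \<sigma>)"
proof (rule Bochner_Integration.integrable_bound[OF integrable_two_power[of "\<sigma> - 1" "\<sigma> - 2"]])
  show "AE w in lborel. norm (stieltjes \<sigma> w) \<le> norm (two_power (\<sigma> - 1) (\<sigma> - 2) w)"
  proof (intro AE_I2)
    fix w :: real
    have "w powr (\<sigma> - 1) / (1 + w) \<le> w powr (\<sigma> - 2)" if "w > 1"
    proof -
      have "w powr (\<sigma> - 1) / (1 + w) \<le> w powr (\<sigma> - 1) / w"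
        using that by (intro divide_left_mono) auto
      also have "\<dots> = w powr (\<sigma> - 1) / w powr 1" using that by simp
      also have "\<dots> = w powr (\<sigma> - 1 - 1)" by (rule powr_diff[symmetric])
      also have "\<sigma> - 1 - 1 = \<sigma> - 2" by simp
      finally show ?thesis .
    qed
    moreover have "w powr (\<sigma> - 1) / (1 + w) \<le> w powr (\<sigma> - 1)" if "w > 0"
      using that by (simp add: field_simps)
    ultimately show "norm (stieltjes \<sigma> w) \<le> norm (two_power (\<sigma> - 1) (\<sigma> - 2) w)"
      by (auto simp: stieltjes_def two_power_def)
  qed
qed (use assms in auto)

definition stieltjes_const :: "real \<Rightarrow> real" where
  "stieltjes_const \<sigma> = integral\<^sup>L lborel (stieltjes \<sigma>)"

lemma stieltjes_const_pos:
  assumes "0 < \<sigma>" "\<sigma> < 1"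
  shows "stieltjes_const \<sigma> > 0"
proof -
  define c where "c = 2 powr (\<sigma> - 1) / 3"
  have "c * indicator {1..2} w \<le> stieltjes \<sigma> w" for w
  proof (cases "w \<in> {1..2}")
    case True
    have "2 powr (\<sigma> - 1) / 3 \<le> w powr (\<sigma> - 1) / (1 + w)"
      using True assms by (intro frac_le powr_mono2') auto
    then show ?thesis using True by (simp add: c_def stieltjes_def)
  qed (simp add: stieltjes_def)
  then have "integral\<^sup>L lborel (\<lambda>w::real. c * indicator {1..2} w) \<le> stieltjes_const \<sigma>"
    unfolding stieltjes_const_def
    by (intro integral_mono integrable_stieltjes assms) auto
  moreover have "c > 0" by (simp add: c_def)
  ultimately show ?thesis by simp
qed

text \<open>
  Fractional powers as superpositions of the rational functions \<open>y ^ (m + 1) / (y + v)\<close>, by the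
  substitution \<open>v = y w\<close>.  The factor \<open>y ^ (m + 1)\<close> extends the formula for exponents in \<open>(0, 1)\<close> to
  exponents in \<open>(m, m + 1)\<close>.
\<close>
lemma has_bochner_integral_stieltjes:
  assumes \<sigma>: "0 < \<sigma>" "\<sigma> < 1" and y: "y \<ge> 0"
  shows "has_bochner_integral lborel
           (\<lambda>v. if v > 0 then v powr (\<sigma> - 1) * (y ^ Suc m / (y + v)) else 0)
           (stieltjes_const \<sigma> * y powr (real m + \<sigma>))"
proof (cases "y = 0")
  case True
  then show ?thesis by (simp add: has_bochner_integral_zero cong: if_cong)
next
  case False
  with y have y: "y > 0" by simp
  have "has_bochner_integral lborel (stieltjes \<sigma>) (stieltjes_const \<sigma>)"
    using integrable_stieltjes[OF \<sigma>] by (simp add: has_bochner_integral_iff stieltjes_const_def)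
  then have "has_bochner_integral lborel (\<lambda>v. stieltjes \<sigma> (v / y)) (stieltjes_const \<sigma> * y)"
    using y by (subst (asm) lborel_has_bochner_integral_real_affine_iff[of "1 / y" _ _ 0]) (auto simp: mult.commute)
  then have "has_bochner_integral lborel (\<lambda>v. y powr (real m + \<sigma> - 1) * stieltjes \<sigma> (v / y))
      (y powr (real m + \<sigma> - 1) * (stieltjes_const \<sigma> * y))"
    by (intro has_bochner_integral_mult_right)
  moreover have "y powr (real m + \<sigma> - 1) * stieltjes \<sigma> (v / y)
      = (if v > 0 then v powr (\<sigma> - 1) * (y ^ Suc m / (y + v)) else 0)" for v
  proof (cases "v > 0")
    case True
    have "y powr (real m + \<sigma> - 1) = y ^ m * y powr (\<sigma> - 1)"
      using y by (simp add: powr_add flip: powr_realpow add_diff_eq)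
    moreover have "stieltjes \<sigma> (v / y) = v powr (\<sigma> - 1) / y powr (\<sigma> - 1) * (y / (y + v))"
    proof -
      have "1 + v / y = (y + v) / y" using y by (simp add: field_simps)
      then show ?thesis using y True by (simp add: stieltjes_def powr_divide)
    qed
    ultimately show ?thesis using y True by simp
  qed (use y in \<open>simp add: stieltjes_def zero_less_divide_iff\<close>)
  moreover have "y powr (real m + \<sigma> - 1) * (stieltjes_const \<sigma> * y) = stieltjes_const \<sigma> * y powr (real m + \<sigma>)"
    using y by (simp add: powr_diff)
  ultimately show ?thesis by simp
qed

text \<open>
  The error functional commutes with the superposition: for the nodes this is linearity, for
  the integral over \<open>{-1..1}\<close> it is Fubini's theorem, applicable since the integrand is nonnegative.
\<close>
lemma has_bochner_integral_cc_error_power: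
  assumes \<sigma>: "0 < \<sigma>" "\<sigma> < 1"
  shows "has_bochner_integral lborel
           (\<lambda>v. if v > 0 then v powr (\<sigma> - 1) * cc_error n (\<lambda>x. (1 - x) ^ Suc m / (1 + v - x)) else 0)
           (stieltjes_const \<sigma> * cc_error n (\<lambda>x. (1 - x) powr (real m + \<sigma>)))"
proof -
  interpret lborel_pair: pair_sigma_finite "lborel :: real measure" "lborel :: real measure" ..
  define k where "k = (\<lambda>x v. if v > 0 then v powr (\<sigma> - 1) * ((1 - x) ^ Suc m / (1 + v - x)) else 0)"
  define F where "F = (\<lambda>x v. indicator {-1..1} x * k x v)"
  define c where "c = stieltjes_const \<sigma>"
  define G where "G = (\<lambda>x::real. c * (1 - x) powr (real m + \<sigma>))"
  have k: "has_bochner_integral lborel (k x) (G x)" if "x \<in> {-1..1}" for x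
    using has_bochner_integral_stieltjes[OF \<sigma>, of "1 - x" m] that
    by (simp add: k_def c_def G_def algebra_simps cong: if_cong)
  have F: "has_bochner_integral lborel (F x) (indicator {-1..1} x * G x)" for x
    unfolding F_def by (cases "x \<in> {-1..1}") (auto intro: k)
  have Fpos: "F x v \<ge> 0" for x v
    by (auto simp: F_def k_def indicator_def)
  have contG: "continuous_on {-1..1} G"
    unfolding G_def using \<sigma> by (intro continuous_intros continuous_on_powr') auto
  have intG: "set_integrable lborel {-1..1} G"
    using contG by (rule borel_integrable_atLeastAtMost')
  have intF: "integrable (lborel \<Otimes>\<^sub>M lborel) (case_prod F)"
  proof (rule lborel_pair.Fubini_integrable)
    show "case_prod F \<in> borel_measurable (lborel \<Otimes>\<^sub>M lborel)"
      unfolding F_def k_def by measurable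
    show "integrable lborel (\<lambda>x. LINT v|lborel. norm (case (x, v) of (x, v) \<Rightarrow> F x v))"
      using intG F Fpos by (simp add: set_integrable_def has_bochner_integral_iff)
    show "AE x in lborel. integrable lborel (\<lambda>v. case (x, v) of (x, v) \<Rightarrow> F x v)"
      using F by (simp add: has_bochner_integral_iff)
  qed
  have inner: "(LINT x|lborel. F x v)
      = (if v > 0 then v powr (\<sigma> - 1) * integral {-1..1} (\<lambda>x. (1 - x) ^ Suc m / (1 + v - x)) else 0)" for v
  proof (cases "v > 0")
    case True
    have "(LINT x|lborel. F x v) = (LINT x:{-1..1}|lborel. k x v)"
      by (simp add: F_def set_lebesgue_integral_def)
    also have "\<dots> = integral {-1..1} (\<lambda>x. k x v)"
    proof (intro set_borel_integral_eq_integral borel_integrable_atLeastAtMost')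
      have "continuous_on {-1..1} (\<lambda>x. v powr (\<sigma> - 1) * ((1 - x) ^ Suc m / (1 + v - x)))"
        using True by (intro continuous_intros) auto
      then show "continuous_on {-1..1} (\<lambda>x. k x v)" using True by (simp add: k_def)
    qed
    finally show ?thesis
      using True by (simp add: k_def del: power_Suc times_divide_eq_right)
  qed (simp add: F_def k_def)
  have 1: "has_bochner_integral lborel (\<lambda>v. LINT x|lborel. F x v) (integral {-1..1} G)"
  proof -
    have "integrable lborel (\<lambda>v. LINT x|lborel. F x v)"
      using lborel_pair.integrable_snd[OF intF] .
    moreover have "(LINT v|lborel. LINT x|lborel. F x v) = integral {-1..1} G"
    proof -
      have "(LINT v|lborel. LINT x|lborel. F x v) = (LINT x|lborel. LINT v|lborel. F x v)"
        by (rule lborel_pair.Fubini_integral[OF intF])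
      also have "\<dots> = (LINT x:{-1..1}|lborel. G x)"
        using F by (simp add: set_lebesgue_integral_def has_bochner_integral_iff)
      also have "\<dots> = integral {-1..1} G"
        by (rule set_borel_integral_eq_integral[OF intG])
      finally show ?thesis .
    qed
    ultimately show ?thesis by (simp add: has_bochner_integral_iff)
  qed
  have 2: "has_bochner_integral lborel (\<lambda>v. \<Sum>j=0..n. cc_weight n j * k (cc_node n j) v)
      (\<Sum>j=0..n. cc_weight n j * G (cc_node n j))"
    by (intro has_bochner_integral_sum has_bochner_integral_mult_right k cc_node_mem)
  have "has_bochner_integral lborel (\<lambda>v. (LINT x|lborel. F x v) - (\<Sum>j=0..n. cc_weight n j * k (cc_node n j) v))
      (cc_error n G)"
    using has_bochner_integral_diff[OF 1 2] by (simp add: cc_error_def clenshaw_curtis_def)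
  moreover have "(LINT x|lborel. F x v) - (\<Sum>j=0..n. cc_weight n j * k (cc_node n j) v)
      = (if v > 0 then v powr (\<sigma> - 1) * cc_error n (\<lambda>x. (1 - x) ^ Suc m / (1 + v - x)) else 0)" for v
    unfolding inner
    by (auto simp: k_def cc_error_def clenshaw_curtis_def right_diff_distrib sum_distrib_left mult.left_commute
             intro!: sum.cong)
  ultimately show ?thesis by (simp add: G_def c_def cc_error_cmult)
qed

text \<open>
  The integrand of the superposition is at most a constant times
  \<open>v powr \<gamma> / z\<close> for \<open>z \<le> 1\<close> and \<open>v powr \<gamma> / z ^ R\<close> for \<open>z > 1\<close>, where \<open>z = n\<^sup>2 v\<close>.  Scaling from \<open>v\<close>
  to \<open>z\<close> extracts \<open>(n\<^sup>2) powr (- \<gamma>)\<close> from the power and \<open>1 / n\<^sup>2\<close> from the measure.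
\<close>
lemma cc_error_one_minus_power_bigo:
  assumes \<gamma>: "\<gamma> > 0" "\<gamma> \<notin> \<int>"
  shows "(\<lambda>n. cc_error n (\<lambda>x. (1 - x) powr \<gamma>)) \<in> O(\<lambda>n. real n powr (- 2 * \<gamma> - 2))"
proof -
  define m where "m = nat \<lfloor>\<gamma>\<rfloor>"
  define \<sigma> where "\<sigma> = \<gamma> - real m"
  have m: "real m = of_int \<lfloor>\<gamma>\<rfloor>" using \<gamma> by (simp add: m_def)
  have \<sigma>: "0 < \<sigma>" "\<sigma> < 1"
  proof -
    have "of_int \<lfloor>\<gamma>\<rfloor> \<noteq> \<gamma>" using \<gamma>(2) by (metis Ints_of_int)
    then show "0 < \<sigma>" "\<sigma> < 1" unfolding \<sigma>_def m by linarith+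
  qed
  have \<gamma>_eq: "\<gamma> = real m + \<sigma>" by (simp add: \<sigma>_def)
  \<comment> \<open>large enough for \<open>z powr (\<gamma> - R)\<close> to be integrable at infinity\<close>
  define R where "R = m + 3"
  define K where "K = 4 * (4 * real R) ^ (2 * R - 1)"
  define B where "B = integral\<^sup>L lborel (two_power (\<gamma> - 1) (\<gamma> - real R))"
  define c where "c = stieltjes_const \<sigma>"
  have c: "c > 0" unfolding c_def by (rule stieltjes_const_pos[OF \<sigma>])
  have K: "4 * (4 * real 1) ^ (2 * 1 - 1) \<le> K"
  proof -
    have "(4 * real R) ^ 1 \<le> (4 * real R) ^ (2 * R - 1)"
      by (intro power_increasing) (auto simp: R_def)
    then show ?thesis by (simp add: K_def R_def)
  qed
  have bound: "\<bar>cc_error n (\<lambda>x. (1 - x) powr \<gamma>)\<bar> \<le> K * B / c * real n powr (- 2 * \<gamma> - 2)"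
    if n: "n \<ge> 2 * R - 1" for n
  proof -
    have n1: "n \<ge> 1" "Suc m \<le> Suc n" using n by (auto simp: R_def)
    define N where "N = (real n)\<^sup>2"
    have N: "N > 0" using n1 by (simp add: N_def)
    define h where "h = (\<lambda>v. if v > 0 then v powr (\<sigma> - 1) * cc_error n (\<lambda>x. (1 - x) ^ Suc m / (1 + v - x)) else 0)"
    have h: "has_bochner_integral lborel h (c * cc_error n (\<lambda>x. (1 - x) powr \<gamma>))"
      unfolding h_def c_def \<gamma>_eq by (rule has_bochner_integral_cc_error_power[OF \<sigma>])
    have "has_bochner_integral lborel (two_power (\<gamma> - 1) (\<gamma> - real R)) B"
      using integrable_two_power[of "\<gamma> - 1" "\<gamma> - real R"] \<gamma> \<sigma>
      by (simp add: has_bochner_integral_iff B_def R_def \<sigma>_def)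
    then have "has_bochner_integral lborel (\<lambda>v. two_power (\<gamma> - 1) (\<gamma> - real R) (N * v)) (B / N)"
      using N by (subst (asm) lborel_has_bochner_integral_real_affine_iff[of N _ _ 0]) (auto simp: divide_inverse mult.commute)
    then have maj: "has_bochner_integral lborel
        (\<lambda>v. K * N powr (- \<gamma>) * two_power (\<gamma> - 1) (\<gamma> - real R) (N * v)) (K * N powr (- \<gamma>) * (B / N))"
      by (intro has_bochner_integral_mult_right)
    have le: "norm (h v) \<le> K * N powr (- \<gamma>) * two_power (\<gamma> - 1) (\<gamma> - real R) (N * v)" for v
    proof (cases "v > 0")
      case True
      define z where "z = N * v"
      have z: "z > 0" using True N by (simp add: z_def)
      define e where "e = \<bar>cc_error n (\<lambda>x. 1 / (1 + v - x))\<bar>"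
      have deg: "degree ([:1, -1:] ^ Suc m :: real poly) \<le> Suc n"
        using n1 by (simp add: degree_power_eq del: power_Suc)
      have "cc_error n (\<lambda>x. poly ([:1, -1:] ^ Suc m) x / (1 + v - x))
          = poly ([:1, -1:] ^ Suc m) (1 + v) * cc_error n (\<lambda>x. 1 / (1 + v - x))"
        using True by (intro cc_error_poly_div n1 deg) auto
      then have "cc_error n (\<lambda>x. (1 - x) ^ Suc m / (1 + v - x)) = (- v) ^ Suc m * cc_error n (\<lambda>x. 1 / (1 + v - x))"
        by (simp add: poly_power del: power_Suc)
      then have "norm (h v) = v powr (\<sigma> - 1) * v ^ Suc m * e"
        using True by (simp add: h_def e_def abs_mult power_abs)
      also have "v powr (\<sigma> - 1) * v ^ Suc m = v powr (\<sigma> - 1 + real (Suc m))"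
        unfolding powr_add using True by (simp only: powr_realpow)
      also have "\<sigma> - 1 + real (Suc m) = \<gamma>" by (simp add: \<gamma>_eq)
      also have "v powr \<gamma> = N powr (- \<gamma>) * z powr \<gamma>"
        using N True by (simp add: z_def powr_mult powr_minus)
      also have "N powr (- \<gamma>) * z powr \<gamma> * e
          \<le> N powr (- \<gamma>) * z powr \<gamma> * (K / (if z \<le> 1 then z else z ^ R))"
      proof (intro mult_left_mono)
        show "e \<le> K / (if z \<le> 1 then z else z ^ R)"
        proof (cases "z \<le> 1")
          case True
          have "e \<le> 4 * (4 * real 1) ^ (2 * 1 - 1) / z ^ 1"
            unfolding e_def z_def N_def by (rule abs_cc_error_kernel_le) (use n1 \<open>v > 0\<close> in auto)
          also have "\<dots> \<le> K / z ^ 1" using K z by (intro divide_right_mono) auto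
          finally show ?thesis using True by simp
        next
          case False
          have "e \<le> K / z ^ R"
            unfolding e_def z_def N_def K_def
            by (rule abs_cc_error_kernel_le) (use n \<open>v > 0\<close> in \<open>auto simp: R_def\<close>)
          then show ?thesis using False by simp
        qed
      qed auto
      also have "z powr \<gamma> / (if z \<le> 1 then z else z ^ R) = two_power (\<gamma> - 1) (\<gamma> - real R) z"
        using z by (simp add: two_power_def powr_diff powr_realpow)
      then have "N powr (- \<gamma>) * z powr \<gamma> * (K / (if z \<le> 1 then z else z ^ R))
          = K * N powr (- \<gamma>) * two_power (\<gamma> - 1) (\<gamma> - real R) z"
        by (metis (no_types, opaque_lifting) mult.assoc mult.commute times_divide_eq_right)
      finally show ?thesis by (simp add: z_def)
    qed (use N K in \<open>auto simp: h_def two_power_nonneg\<close>)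
    have "\<bar>c * cc_error n (\<lambda>x. (1 - x) powr \<gamma>)\<bar> = norm (integral\<^sup>L lborel h)"
      using h by (simp add: has_bochner_integral_iff)
    also have "\<dots> \<le> integral\<^sup>L lborel (\<lambda>v. K * N powr (- \<gamma>) * two_power (\<gamma> - 1) (\<gamma> - real R) (N * v))"
      using maj h le by (intro Bochner_Integration.integral_norm_bound_integral) (auto simp: has_bochner_integral_iff)
    also have "\<dots> = K * N powr (- \<gamma>) * (B / N)"
      using maj by (simp add: has_bochner_integral_iff)
    also have "\<dots> = K * B * (N powr (- \<gamma>) / N)" by simp
    also have "N powr (- \<gamma>) / N = N powr (- \<gamma> - 1)" using N by (simp add: powr_diff)
    also have "N powr (- \<gamma> - 1) = (real n powr 2) powr (- \<gamma> - 1)"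
      using n1 by (simp add: N_def powr_numeral)
    also have "\<dots> = real n powr (- 2 * \<gamma> - 2)"
    proof -
      have "2 * (- \<gamma> - 1) = - 2 * \<gamma> - 2" by simp
      then show ?thesis by (simp only: powr_powr)
    qed
    finally show ?thesis using c by (simp add: abs_mult field_simps)
  qed
  show ?thesis
  proof (rule bigoI[of _ "K * B / c"], rule eventually_sequentiallyI)
    fix n assume "n \<ge> 2 * R - 1"
    from bound[OF this] show "norm (cc_error n (\<lambda>x. (1 - x) powr \<gamma>)) \<le> K * B / c * norm (real n powr (- 2 * \<gamma> - 2))"
      by (simp only: real_norm_def abs_of_nonneg[OF powr_ge_zero])
  qed
qed

section \<open>Polynomial approximation of differentiable functions\<close>

text \<open>
  Continuous differentiability \<open>k\<close> times on \<open>{-1..1}\<close>, with one-sided derivatives at the endpoints.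
  The recursion over the derivative matches the inductions below, where the
  derivative of a product or of a fractional power is again of the form at hand.
\<close>
primrec cont_diff :: "nat \<Rightarrow> (real \<Rightarrow> real) \<Rightarrow> bool" where
  "cont_diff 0 f \<longleftrightarrow> continuous_on {-1..1} f"
| "cont_diff (Suc k) f \<longleftrightarrow>
     (\<exists>f'. (\<forall>x\<in>{-1..1}. (f has_real_derivative f' x) (at x within {-1..1})) \<and> cont_diff k f')"

lemma cont_diff_SucI:
  assumes "\<And>x. x \<in> {-1..1} \<Longrightarrow> (f has_real_derivative f' x) (at x within {-1..1})" "cont_diff k f'"
  shows "cont_diff (Suc k) f"
  using assms unfolding cont_diff.simps by blast

lemma cont_diff_continuous_on: "cont_diff k f \<Longrightarrow> continuous_on {-1..1} f"
  by (cases k) (auto simp: continuous_on_eq_continuous_within intro: DERIV_continuous)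

lemma cont_diff_SucD: "cont_diff (Suc k) f \<Longrightarrow> cont_diff k f"
proof (induction k arbitrary: f)
  case 0
  then show ?case using cont_diff_continuous_on by (simp del: cont_diff.simps(2))
next
  case (Suc k)
  then obtain f' where "\<forall>x\<in>{-1..1}. (f has_real_derivative f' x) (at x within {-1..1})" "cont_diff (Suc k) f'"
    using cont_diff.simps(2)[of "Suc k" f] by blast
  with Suc.IH[of f'] show ?case using cont_diff.simps(2)[of k f] by blast
qed

lemma cont_diff_cong:
  assumes "cont_diff k f" "\<And>x. x \<in> {-1..1} \<Longrightarrow> f x = h x"
  shows "cont_diff k h"
proof (cases k)
  case 0
  then show ?thesis using assms continuous_on_eq[of "{-1..1}" f h] by simp
next
  case (Suc j)
  then obtain f' where f': "\<And>x. x \<in> {-1..1} \<Longrightarrow> (f has_real_derivative f' x) (at x within {-1..1})" "cont_diff j f'"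
    using assms(1) unfolding Suc cont_diff.simps by blast
  have "(h has_real_derivative f' x) (at x within {-1..1})" if x: "x \<in> {-1..1}" for x
    by (rule has_field_derivative_transform_within[OF f'(1)[OF x] zero_less_one x]) (rule assms(2))
  from cont_diff_SucI[OF this f'(2)] show ?thesis unfolding Suc .
qed

lemma cont_diff_add: "cont_diff k f \<Longrightarrow> cont_diff k h \<Longrightarrow> cont_diff k (\<lambda>x. f x + h x)"
proof (induction k arbitrary: f h)
  case (Suc k)
  from Suc.prems(1) obtain f' where
    f': "\<And>x. x \<in> {-1..1} \<Longrightarrow> (f has_real_derivative f' x) (at x within {-1..1})" "cont_diff k f'"
    unfolding cont_diff.simps by blast
  from Suc.prems(2) obtain h' where
    h': "\<And>x. x \<in> {-1..1} \<Longrightarrow> (h has_real_derivative h' x) (at x within {-1..1})" "cont_diff k h'"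
    unfolding cont_diff.simps by blast
  have "((\<lambda>x. f x + h x) has_real_derivative f' x + h' x) (at x within {-1..1})" if "x \<in> {-1..1}" for x
    using f'(1) h'(1) that by (intro DERIV_add) auto
  moreover have "cont_diff k (\<lambda>x. f' x + h' x)" using Suc.IH f'(2) h'(2) .
  ultimately show ?case by (rule cont_diff_SucI)
qed (simp add: continuous_on_add)

lemma cont_diff_mult: "cont_diff k f \<Longrightarrow> cont_diff k h \<Longrightarrow> cont_diff k (\<lambda>x. f x * h x)"
proof (induction k arbitrary: f h)
  case (Suc k)
  from Suc.prems(1) obtain f' where
    f': "\<And>x. x \<in> {-1..1} \<Longrightarrow> (f has_real_derivative f' x) (at x within {-1..1})" "cont_diff k f'"
    unfolding cont_diff.simps by blast
  from Suc.prems(2) obtain h' where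
    h': "\<And>x. x \<in> {-1..1} \<Longrightarrow> (h has_real_derivative h' x) (at x within {-1..1})" "cont_diff k h'"
    unfolding cont_diff.simps by blast
  have "((\<lambda>x. f x * h x) has_real_derivative f' x * h x + h' x * f x) (at x within {-1..1})"
    if "x \<in> {-1..1}" for x
    using f'(1) h'(1) that by (intro DERIV_mult) auto
  moreover have "cont_diff k (\<lambda>x. f' x * h x + h' x * f x)"
    using Suc.IH[OF f'(2) cont_diff_SucD[OF Suc.prems(2)]] Suc.IH[OF h'(2) cont_diff_SucD[OF Suc.prems(1)]]
    by (rule cont_diff_add)
  ultimately show ?case by (rule cont_diff_SucI)
qed (simp add: continuous_on_mult)

lemma cont_diff_poly: "cont_diff k (poly p)"
proof (induction k arbitrary: p)
  case (Suc k)
  have "(poly p has_real_derivative poly (pderiv p) x) (at x within {-1..1})" for x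
    by (rule has_field_derivative_at_within[OF poly_DERIV])
  then show ?case using Suc by (rule cont_diff_SucI)
qed (simp add: continuous_on_poly continuous_on_id)

lemma cont_diff_const: "cont_diff k (\<lambda>_. c)"
  by (rule cont_diff_cong[OF cont_diff_poly[of k "[:c:]"]]) simp

lemma cont_diff_reflect: "cont_diff k f \<Longrightarrow> cont_diff k (\<lambda>x. f (- x))"
proof (induction k arbitrary: f)
  case 0
  then show ?case
    by (auto intro!: continuous_on_compose2[of "{-1..1}" f] continuous_intros)
next
  case (Suc k)
  then obtain f' where
    f': "\<And>x. x \<in> {-1..1} \<Longrightarrow> (f has_real_derivative f' x) (at x within {-1..1})" "cont_diff k f'"
    unfolding cont_diff.simps by blast
  have "((\<lambda>x. f (- x)) has_real_derivative - 1 * f' (- x)) (at x within {-1..1})" if "x \<in> {-1..1}" for x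
  proof -
    have *: "uminus ` {-1..1} = {-1..1::real}" by simp
    have "(f has_real_derivative f' (- x)) (at (- x) within uminus ` {-1..1})"
      unfolding * using that by (intro f'(1)) auto
    moreover have "(uminus has_real_derivative -1) (at x within {-1..1})"
      by (auto intro!: derivative_eq_intros)
    ultimately have "(f \<circ> uminus has_real_derivative f' (- x) * -1) (at x within {-1..1})"
      by (rule DERIV_image_chain)
    then show ?thesis by (simp add: o_def)
  qed
  moreover have "cont_diff k (\<lambda>x. - 1 * f' (- x))"
    by (intro cont_diff_mult cont_diff_const Suc.IH f'(2))
  ultimately show ?case by (rule cont_diff_SucI)
qed

lemma C_infinity_on_imp_cont_diff:
  assumes "C_infinity_on {-1..1} g"
  shows "cont_diff k g"
proof -
  obtain G where G: "\<And>x. x \<in> {-1..1} \<Longrightarrow> G 0 x = g x"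
    "\<And>k x. x \<in> {-1..1} \<Longrightarrow> (G k has_real_derivative G (Suc k) x) (at x within {-1..1})"
    using assms unfolding C_infinity_on_def by blast
  have "cont_diff k (G i)" for i
  proof (induction k arbitrary: i)
    case 0
    show ?case
      using DERIV_continuous[OF G(2)] unfolding cont_diff.simps continuous_on_eq_continuous_within by blast
  next
    case (Suc k)
    show ?case by (rule cont_diff_SucI[OF G(2) Suc])
  qed
  from cont_diff_cong[OF this[of 0] G(1)] show ?thesis .
qed

lemma ex_pderiv_eq:
  fixes p :: "real poly"
  shows "\<exists>P. pderiv P = p \<and> degree P \<le> Suc (degree p)"
proof -
  define P where "P = (\<Sum>i\<le>degree p. monom (coeff p i / real (Suc i)) (Suc i))"
  have "pderiv P = (\<Sum>i\<le>degree p. monom (coeff p i) i)"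
    unfolding P_def
    using higher_pderiv_sum[of 1 "\<lambda>i. monom (coeff p i / real (Suc i)) (Suc i)" "{..degree p}"]
    by (simp add: pderiv_monom del: of_nat_Suc)
  also have "\<dots> = p" by (rule poly_as_sum_of_monoms)
  finally have "pderiv P = p" .
  moreover have "degree P \<le> Suc (degree p)"
    unfolding P_def by (intro degree_sum_le) (auto intro: order_trans[OF degree_monom_le])
  ultimately show ?thesis by blast
qed

lemma Bernstein_variance:
  assumes "n \<ge> 1"
  shows "(\<Sum>k\<le>n. (s - real k / real n)\<^sup>2 * Bernstein n k s) = s * (1 - s) / real n"
proof -
  have "(\<Sum>k\<le>n. (s - real k / real n)\<^sup>2 * Bernstein n k s)
      = (\<Sum>k\<le>n. 1 / (real n)\<^sup>2 * (real k * (real k - 1) * Bernstein n k s)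
          + (1 - 2 * real n * s) / (real n)\<^sup>2 * (real k * Bernstein n k s) + s\<^sup>2 * Bernstein n k s)"
    using assms by (intro sum.cong refl) (simp add: field_simps power2_eq_square)
  also have "\<dots> = 1 / (real n)\<^sup>2 * (real n * (real n - 1) * s\<^sup>2) + (1 - 2 * real n * s) / (real n)\<^sup>2 * (real n * s) + s\<^sup>2"
    by (simp only: sum.distrib sum_distrib_left[symmetric] sum_kk_Bernstein sum_k_Bernstein sum_Bernstein mult_1_right)
  also have "\<dots> = s * (1 - s) / real n"
    using assms by (simp add: field_simps power2_eq_square)
  finally show ?thesis .
qed

text \<open>
  The Bernstein polynomial of \<open>f\<close>, transplanted from \<open>{0..1}\<close>: its error at \<open>x\<close> is at most \<open>L\<close> times
  the mean distance of a binomially distributed node from \<open>x\<close>, and the standard deviation of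
  the binomial distribution is of order \<open>1 / sqrt n\<close>.
\<close>
lemma Lipschitz_poly_approx:
  fixes f :: "real \<Rightarrow> real"
  assumes L: "L \<ge> 0" and f: "\<And>x y. x \<in> {-1..1} \<Longrightarrow> y \<in> {-1..1} \<Longrightarrow> \<bar>f x - f y\<bar> \<le> L * \<bar>x - y\<bar>"
    and n: "n \<ge> 1"
  shows "\<exists>p. degree p \<le> n \<and> (\<forall>x\<in>{-1..1}. \<bar>f x - poly p x\<bar> \<le> 2 * L / sqrt (real n))"
proof -
  define node where "node = (\<lambda>k. 2 * (real k / real n) - 1)"
  define p where "p = (\<Sum>k\<le>n. smult (f (node k) * real (n choose k)) ([:1/2, 1/2:] ^ k * [:1/2, -1/2:] ^ (n - k)))"
  have "degree p \<le> n"
    unfolding p_def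
  proof (intro degree_sum_le)
    fix k assume "k \<in> {..n}"
    have "degree ([:1/2, 1/2:] ^ k * [:1/2, -1/2:] ^ (n - k) :: real poly)
        \<le> degree ([:1/2, 1/2:] ^ k :: real poly) + degree ([:1/2, -1/2:] ^ (n - k) :: real poly)"
      by (rule degree_mult_le)
    also have "\<dots> \<le> k + (n - k)"
      by (simp add: degree_power_eq)
    also have "\<dots> = n" using \<open>k \<in> {..n}\<close> by simp
    finally show "degree (smult (f (node k) * real (n choose k)) ([:1/2, 1/2:] ^ k * [:1/2, -1/2:] ^ (n - k))) \<le> n"
      by (rule order_trans[OF degree_smult_le])
  qed simp
  moreover have "\<bar>f x - poly p x\<bar> \<le> 2 * L / sqrt (real n)" if x: "x \<in> {-1..1}" for x
  proof -
    define s where "s = (1 + x) / 2"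
    have s: "0 \<le> s" "s \<le> 1" "x = 2 * s - 1" using x by (auto simp: s_def field_simps)
    have px: "poly p x = (\<Sum>k\<le>n. f (node k) * Bernstein n k s)"
      unfolding p_def poly_sum
    proof (intro sum.cong refl)
      fix k
      have "poly [:1/2, 1/2:] x = s" "poly [:1/2, -1/2:] x = 1 - s"
        by (simp_all add: s_def field_simps)
      then show "poly (smult (f (node k) * real (n choose k)) ([:1/2, 1/2:] ^ k * [:1/2, -1/2:] ^ (n - k))) x
          = f (node k) * Bernstein n k s"
        by (simp only: poly_smult poly_mult poly_power Bernstein_def mult.assoc)
    qed
    have "f x = (\<Sum>k\<le>n. f x * Bernstein n k s)"
      by (simp only: sum_distrib_left[symmetric] sum_Bernstein mult_1_right)
    then have "\<bar>f x - poly p x\<bar> = \<bar>\<Sum>k\<le>n. (f x - f (node k)) * Bernstein n k s\<bar>"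
      by (simp add: px left_diff_distrib sum_subtractf)
    also have "\<dots> \<le> (\<Sum>k\<le>n. L * (sqrt (real n) * (s - real k / real n)\<^sup>2 + 1 / sqrt (real n)) * Bernstein n k s)"
    proof (intro order_trans[OF sum_abs] sum_mono)
      fix k assume k: "k \<in> {..n}"
      have node: "node k \<in> {-1..1}"
        using k n by (auto simp: node_def field_simps)
      define d where "d = \<bar>s - real k / real n\<bar>"
      have q: "sqrt (real n) > 0" using n by simp
      \<comment> \<open>the arithmetic-geometric mean inequality replaces the Cauchy-Schwarz inequality\<close>
      have "2 * d \<le> sqrt (real n) * d\<^sup>2 + 1 / sqrt (real n)"
      proof -
        have "0 \<le> (sqrt (real n) * d - 1)\<^sup>2" by simp
        also have "\<dots> = sqrt (real n) * (sqrt (real n) * d\<^sup>2 - 2 * d + 1 / sqrt (real n))"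
          using q by (simp add: power2_eq_square algebra_simps)
        finally have "0 \<le> sqrt (real n) * d\<^sup>2 - 2 * d + 1 / sqrt (real n)"
          using q by (simp add: zero_le_mult_iff)
        then show ?thesis by simp
      qed
      moreover have "\<bar>x - node k\<bar> = 2 * d"
        unfolding s(3) node_def d_def by (simp add: abs_if)
      ultimately have "\<bar>f x - f (node k)\<bar> \<le> L * (sqrt (real n) * d\<^sup>2 + 1 / sqrt (real n))"
        using f[OF x node] L by (intro order_trans[OF f[OF x node]] mult_left_mono) auto
      then have "\<bar>f x - f (node k)\<bar> * Bernstein n k s
          \<le> L * (sqrt (real n) * d\<^sup>2 + 1 / sqrt (real n)) * Bernstein n k s"
        using s by (intro mult_right_mono Bernstein_nonneg)
      then show "\<bar>(f x - f (node k)) * Bernstein n k s\<bar>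
          \<le> L * (sqrt (real n) * (s - real k / real n)\<^sup>2 + 1 / sqrt (real n)) * Bernstein n k s"
        using s by (simp add: abs_mult Bernstein_nonneg d_def)
    qed
    also have "\<dots> = (\<Sum>k\<le>n. L * sqrt (real n) * ((s - real k / real n)\<^sup>2 * Bernstein n k s) + L / sqrt (real n) * Bernstein n k s)"
      by (intro sum.cong refl) (simp add: algebra_simps)
    also have "\<dots> = L * sqrt (real n) * (s * (1 - s) / real n) + L / sqrt (real n)"
      by (simp only: sum.distrib sum_distrib_left[symmetric] Bernstein_variance[OF n] sum_Bernstein mult_1_right)
    also have "\<dots> \<le> L * sqrt (real n) * (1 / real n) + L / sqrt (real n)"
    proof -
      have "s * (1 - s) \<le> 1 * 1" using s by (intro mult_mono) auto
      then show ?thesis using L by (intro add_right_mono mult_left_mono divide_right_mono) auto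
    qed
    also have "\<dots> = 2 * L / sqrt (real n)"
    proof -
      have "sqrt (real n) * (1 / real n) = 1 / sqrt (real n)"
        using n by (simp add: field_simps)
      then show ?thesis by (simp only: mult.assoc) simp
    qed
    finally show ?thesis .
  qed
  ultimately show ?thesis by blast
qed

text \<open>
  If \<open>q\<close> approximates \<open>f'\<close> up to \<open>\<epsilon>\<close> and \<open>Q\<close> is a primitive of \<open>q\<close>, then \<open>f - Q\<close> has Lipschitz constant
  \<open>\<epsilon>\<close>; approximating \<open>f - Q\<close> by a Bernstein polynomial gains a factor \<open>2 / sqrt n\<close>.
\<close>
lemma cont_diff_poly_approx:
  assumes "cont_diff K f"
  shows "\<exists>C\<ge>0. \<forall>n\<ge>1. \<exists>p. degree p \<le> n + K \<and> (\<forall>x\<in>{-1..1}. \<bar>f x - poly p x\<bar> \<le> C / sqrt (real n) ^ K)"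
  using assms
proof (induction K arbitrary: f)
  case 0
  then have "continuous_on {-1..1} f" by simp
  from compact_imp_bounded[OF compact_continuous_image[OF this compact_Icc]]
  have "bounded (f ` {-1..1})" .
  then obtain C where "\<forall>y\<in>f ` {-1..1}. norm y \<le> C"
    unfolding bounded_iff by blast
  then have C: "\<bar>f x\<bar> \<le> C" if "x \<in> {-1..1}" for x using that by auto
  have C0: "C \<ge> 0" using C[of 0] by simp
  have "degree (0 :: real poly) \<le> n + 0 \<and> (\<forall>x\<in>{-1..1}. \<bar>f x - poly 0 x\<bar> \<le> C / sqrt (real n) ^ 0)" for n
    using C by simp
  with C0 show ?case by blast
next
  case (Suc K)
  then obtain f' where
    f': "\<And>x. x \<in> {-1..1} \<Longrightarrow> (f has_real_derivative f' x) (at x within {-1..1})" "cont_diff K f'"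
    unfolding cont_diff.simps by blast
  from Suc.IH[OF this(2)] obtain C where C: "C \<ge> 0"
    "\<And>n. n \<ge> 1 \<Longrightarrow> \<exists>p. degree p \<le> n + K \<and> (\<forall>x\<in>{-1..1}. \<bar>f' x - poly p x\<bar> \<le> C / sqrt (real n) ^ K)"
    by blast
  show ?case
  proof (intro exI[of _ "2 * C"] conjI allI impI)
    fix n :: nat assume n: "n \<ge> 1"
    from C(2)[OF n] obtain q where q: "degree q \<le> n + K"
      "\<And>x. x \<in> {-1..1} \<Longrightarrow> \<bar>f' x - poly q x\<bar> \<le> C / sqrt (real n) ^ K" by blast
    obtain Q where Q: "pderiv Q = q" "degree Q \<le> Suc (degree q)" using ex_pderiv_eq by blast
    define L where "L = C / sqrt (real n) ^ K"
    have L: "L \<ge> 0" using C(1) by (simp add: L_def)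
    define h where "h = (\<lambda>x. f x - poly Q x)"
    have lip: "\<bar>h x - h y\<bar> \<le> L * \<bar>x - y\<bar>" if "x \<in> {-1..1}" "y \<in> {-1..1}" for x y
    proof -
      have dh: "(h has_real_derivative f' z - poly q z) (at z within {-1..1})" if "z \<in> {-1..1}" for z
        using DERIV_diff[OF f'(1)[OF that] has_field_derivative_at_within[OF poly_DERIV[of Q z]]]
        by (simp only: h_def Q(1))
      have "norm (h x - h y) \<le> L * norm (x - y)"
        by (rule field_differentiable_bound[OF convex_real_interval(5) dh]) (use q(2) that in \<open>auto simp: L_def\<close>)
      then show ?thesis by simp
    qed
    from Lipschitz_poly_approx[OF L lip n] obtain r where r: "degree r \<le> n"
      "\<And>x. x \<in> {-1..1} \<Longrightarrow> \<bar>h x - poly r x\<bar> \<le> 2 * L / sqrt (real n)" by blast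
    show "\<exists>p. degree p \<le> n + Suc K \<and> (\<forall>x\<in>{-1..1}. \<bar>f x - poly p x\<bar> \<le> 2 * C / sqrt (real n) ^ Suc K)"
    proof (intro exI[of _ "Q + r"] conjI ballI)
      show "degree (Q + r) \<le> n + Suc K" using Q(2) q(1) r(1) by (intro degree_add_le) auto
      fix x :: real assume "x \<in> {-1..1}"
      then show "\<bar>f x - poly (Q + r) x\<bar> \<le> 2 * C / sqrt (real n) ^ Suc K"
        using r(2)[of x] by (simp add: h_def L_def algebra_simps)
    qed
  qed (use C(1) in auto)
qed

text \<open>
  As polynomials have no error, the error of \<open>f\<close> is that of \<open>f - p\<close> for a good approximation \<open>p\<close>.
\<close>
lemma cc_error_cont_diff_bigo:
  assumes "cont_diff K f"
  shows "(\<lambda>n. cc_error n f) \<in> O(\<lambda>n. real n powr (1 - real K / 2))"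
proof -
  obtain C where C: "C \<ge> 0"
    "\<And>n. n \<ge> 1 \<Longrightarrow> \<exists>p. degree p \<le> n + K \<and> (\<forall>x\<in>{-1..1}. \<bar>f x - poly p x\<bar> \<le> C / sqrt (real n) ^ K)"
    using cont_diff_poly_approx[OF assms] by blast
  have cf: "continuous_on {-1..1} f" by (rule cont_diff_continuous_on[OF assms])
  show ?thesis
  proof (rule bigoI[of _ "14 * C * sqrt 2 ^ K"], rule eventually_sequentiallyI)
    fix n :: nat assume n: "n \<ge> 2 * K + 1"
    then have n1: "n \<ge> 1" "n - K \<ge> 1" "n - K + K = n" by auto
    \<comment> \<open>the parameter \<open>n - K\<close> keeps the degree at most \<open>n\<close> and costs only a constant factor\<close>
    from C(2)[OF n1(2)] obtain p where p: "degree p \<le> n"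
      "\<And>x. x \<in> {-1..1} \<Longrightarrow> \<bar>f x - poly p x\<bar> \<le> C / sqrt (real (n - K)) ^ K" unfolding n1(3) by blast
    have "real n / 2 \<le> real (n - K)" using n by (simp add: of_nat_diff)
    then have "(sqrt (real n) / sqrt 2) ^ K \<le> sqrt (real (n - K)) ^ K"
      by (intro power_mono) (auto simp flip: real_sqrt_divide)
    then have "C / sqrt (real (n - K)) ^ K \<le> C / (sqrt (real n) / sqrt 2) ^ K"
      using C(1) n1 by (intro divide_left_mono) auto
    also have "\<dots> = C * sqrt 2 ^ K * real n powr (- (real K / 2))"
    proof -
      have "sqrt (real n) ^ K = real n powr (real K / 2)"
        using n1 by (simp add: powr_half_sqrt[symmetric] powr_realpow[symmetric] powr_powr)
      then show ?thesis using n1 by (simp add: power_divide powr_minus field_simps)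
    qed
    finally have e: "\<And>x. x \<in> {-1..1} \<Longrightarrow> \<bar>f x - poly p x\<bar> \<le> C * sqrt 2 ^ K * real n powr (- (real K / 2))"
      using p(2) by (meson order_trans)
    have "cc_error n f = cc_error n (\<lambda>x. f x - poly p x)"
      using cf n1 p by (subst cc_error_diff) (auto simp: cc_error_poly intro: continuous_intros)
    also have "\<bar>\<dots>\<bar> \<le> 14 * real n * (C * sqrt 2 ^ K * real n powr (- (real K / 2)))"
      using n1(1) e cf by (intro abs_cc_error_le continuous_intros) auto
    also have "\<dots> = 14 * C * sqrt 2 ^ K * (real n powr 1 * real n powr (- (real K / 2)))" by simp
    also have "\<dots> = 14 * C * sqrt 2 ^ K * real n powr (1 - real K / 2)"
      by (simp only: powr_add[symmetric]) simp
    finally show "norm (cc_error n f) \<le> 14 * C * sqrt 2 ^ K * norm (real n powr (1 - real K / 2))"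
      by (simp only: real_norm_def abs_of_nonneg[OF powr_ge_zero])
  qed
qed

section \<open>Splitting off the endpoint singularity\<close>

text \<open>
  A zero of order \<open>m\<close> at the right endpoint, in the sense of derivatives; the derivatives are part of
  the recursion because \<open>cont_diff_powr_mult_flat\<close> differentiates \<open>R\<close> along with a singular factor.
\<close>
primrec flat :: "nat \<Rightarrow> (real \<Rightarrow> real) \<Rightarrow> bool" where
  "flat 0 R \<longleftrightarrow> continuous_on {-1..1} R"
| "flat (Suc m) R \<longleftrightarrow> R 1 = 0 \<and>
     (\<exists>R'. (\<forall>x\<in>{-1..1}. (R has_real_derivative R' x) (at x within {-1..1})) \<and> flat m R')"

lemma flatE:
  assumes "flat (Suc m) R"
  obtains R' where "R 1 = 0" "\<And>x. x \<in> {-1..1} \<Longrightarrow> (R has_real_derivative R' x) (at x within {-1..1})" "flat m R'"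
  using assms unfolding flat.simps by blast

lemma flat_SucI:
  assumes "R 1 = 0" "\<And>x. x \<in> {-1..1} \<Longrightarrow> (R has_real_derivative R' x) (at x within {-1..1})" "flat m R'"
  shows "flat (Suc m) R"
  using assms unfolding flat.simps by blast

lemma flat_continuous_on:
  assumes "flat m R"
  shows "continuous_on {-1..1} R"
proof (cases m)
  case (Suc j)
  with assms obtain R' where "\<And>x. x \<in> {-1..1} \<Longrightarrow> (R has_real_derivative R' x) (at x within {-1..1})"
    using flatE by blast
  from DERIV_continuous[OF this] show ?thesis unfolding continuous_on_eq_continuous_within by blast
qed (use assms in simp)

text \<open>
  The polynomial is the Taylor polynomial of \<open>h\<close> at \<open>1\<close>, obtained by integrating that of \<open>h'\<close>.
\<close>
lemma ex_poly_flat_diff: "cont_diff m h \<Longrightarrow> \<exists>p. flat m (\<lambda>x. h x - poly p x)"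
proof (induction m arbitrary: h)
  case 0
  then show ?case by (auto intro!: exI[of _ 0])
next
  case (Suc m)
  then obtain h' where
    h': "\<And>x. x \<in> {-1..1} \<Longrightarrow> (h has_real_derivative h' x) (at x within {-1..1})" "cont_diff m h'"
    unfolding cont_diff.simps by blast
  from Suc.IH[OF h'(2)] obtain q where q: "flat m (\<lambda>x. h' x - poly q x)" by blast
  obtain Q where Q: "pderiv Q = q" using ex_pderiv_eq by blast
  define p where "p = Q + [:h 1 - poly Q 1:]"
  have "flat (Suc m) (\<lambda>x. h x - poly p x)"
  proof (rule flat_SucI[OF _ _ q])
    show "h 1 - poly p 1 = 0" by (simp add: p_def)
    fix x :: real assume "x \<in> {-1..1}"
    moreover have "pderiv p = q" by (simp add: p_def pderiv_add pderiv_pCons Q)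
    ultimately show "((\<lambda>x. h x - poly p x) has_real_derivative h' x - poly q x) (at x within {-1..1})"
      using DERIV_diff[OF h'(1) has_field_derivative_at_within[OF poly_DERIV[of p x]]] by simp
  qed
  then show ?case by blast
qed

lemma flat_bound: "flat m R \<Longrightarrow> \<exists>C\<ge>0. \<forall>x\<in>{-1..1}. \<bar>R x\<bar> \<le> C * (1 - x) ^ m"
proof (induction m arbitrary: R)
  case 0
  then have "continuous_on {-1..1} R" by simp
  from compact_imp_bounded[OF compact_continuous_image[OF this compact_Icc]]
  obtain C where "\<forall>y\<in>R ` {-1..1}. norm y \<le> C" unfolding bounded_iff by blast
  then have "\<forall>x\<in>{-1..1}. \<bar>R x\<bar> \<le> C * (1 - x) ^ 0" by simp
  moreover from this have "C \<ge> 0" by force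
  ultimately show ?case by blast
next
  case (Suc m)
  from Suc.prems obtain R' where R1: "R 1 = 0"
    and R': "\<And>x. x \<in> {-1..1} \<Longrightarrow> (R has_real_derivative R' x) (at x within {-1..1})" "flat m R'"
    by (rule flatE) blast
  from Suc.IH[OF R'(2)] obtain C where C: "C \<ge> 0" "\<And>x. x \<in> {-1..1} \<Longrightarrow> \<bar>R' x\<bar> \<le> C * (1 - x) ^ m" by blast
  have "\<bar>R x\<bar> \<le> C * (1 - x) ^ Suc m" if x: "x \<in> {-1..1}" for x
  proof (cases "x = 1")
    case False
    with x have "x < 1" by simp
    moreover have "(R has_derivative (*) (R' z)) (at z within {x..1})" if "x \<le> z" "z \<le> 1" for z
      using DERIV_subset[OF R'(1), of z "{x..1}"] that x unfolding has_field_derivative_def by auto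
    ultimately obtain z where z: "z \<in> {x<..<1}" "R 1 - R x = R' z * (1 - x)"
      using mvt_simple[of x 1 R "\<lambda>z. (*) (R' z)"] by auto
    have "\<bar>R x\<bar> = \<bar>R' z\<bar> * (1 - x)" using z x R1 by (simp add: abs_mult flip: abs_minus_cancel[of "R x"])
    also have "\<dots> \<le> C * (1 - z) ^ m * (1 - x)"
      using z x by (intro mult_right_mono C(2)) auto
    also have "\<dots> \<le> C * (1 - x) ^ m * (1 - x)"
      using z x C(1) by (intro mult_right_mono mult_left_mono power_mono) auto
    finally show ?thesis by (simp add: mult_ac)
  qed (simp add: R1)
  with C(1) show ?case by blast
qed

lemma tendsto_one_minus_powr:
  fixes b C :: real
  assumes "b > 0"
  shows "((\<lambda>x. C * (1 - x) powr b) \<longlongrightarrow> 0) (at 1 within {-1..1})"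
proof -
  have "continuous_on {-1..1} (\<lambda>x. C * (1 - x) powr b)"
    using assms by (intro continuous_intros continuous_on_powr') auto
  then have "((\<lambda>x. C * (1 - x) powr b) \<longlongrightarrow> C * (1 - 1) powr b) (at 1 within {-1..1})"
    unfolding continuous_on_def by (rule bspec) simp
  then show ?thesis by simp
qed

lemma has_real_derivative_zero_at_one:
  assumes b: "b > 1" and f: "\<And>x. x \<in> {-1..1} \<Longrightarrow> \<bar>f x\<bar> \<le> C * (1 - x) powr b"
  shows "(f has_real_derivative 0) (at 1 within {-1..1})"
proof -
  have f1: "f 1 = 0" using f[of 1] by simp
  have "((\<lambda>x. (f x - f 1) / (x - 1)) \<longlongrightarrow> 0) (at 1 within {-1..1})"
  proof (rule Lim_null_comparison[OF _ tendsto_one_minus_powr[of "b - 1" C]])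
    show "\<forall>\<^sub>F x in at 1 within {-1..1}. norm ((f x - f 1) / (x - 1)) \<le> C * (1 - x) powr (b - 1)"
      unfolding eventually_at_filter
    proof (intro always_eventually allI impI)
      fix x :: real assume x: "x \<noteq> 1" "x \<in> {-1..1}"
      then have "\<bar>f x\<bar> / (1 - x) \<le> C * (1 - x) powr b / (1 - x)"
        by (intro divide_right_mono f) auto
      also have "\<dots> = C * (1 - x) powr (b - 1)" using x by (simp add: powr_diff)
      finally show "norm ((f x - f 1) / (x - 1)) \<le> C * (1 - x) powr (b - 1)"
        using x by (simp add: f1)
    qed
  qed (use b in simp)
  then show ?thesis by (simp add: has_field_derivative_iff)
qed

lemma has_real_derivative_one_minus_powr_mult:
  fixes a :: real
  assumes x: "x \<in> {-1..1}" and R: "(R has_real_derivative R') (at x within {-1..1})"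
    and b: "b > 1" "\<And>x. x \<in> {-1..1} \<Longrightarrow> \<bar>(1 - x) powr a * R x\<bar> \<le> C * (1 - x) powr b"
  shows "((\<lambda>x. (1 - x) powr a * R x) has_real_derivative
           (1 - x) powr a * R' + - a * ((1 - x) powr (a - 1) * R x)) (at x within {-1..1})"
proof (cases "x = 1")
  case True
  with has_real_derivative_zero_at_one[OF b] show ?thesis by simp
next
  case False
  with x have pos: "1 - x > 0" by simp
  have "((\<lambda>x. (1 - x) powr a) has_real_derivative - a * (1 - x) powr (a - 1)) (at x within {-1..1})"
    using pos by (auto intro!: derivative_eq_intros simp: powr_diff)
  from DERIV_mult[OF this R] show ?thesis by (simp add: mult_ac add.commute)
qed

lemma continuous_on_one_minus_powr_mult:
  fixes a :: real
  assumes R: "continuous_on {-1..1} R"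
    and b: "b > 0" "\<And>x. x \<in> {-1..1} \<Longrightarrow> \<bar>(1 - x) powr a * R x\<bar> \<le> C * (1 - x) powr b"
  shows "continuous_on {-1..1} (\<lambda>x. (1 - x) powr a * R x)"
  unfolding continuous_on_def
proof
  fix x :: real assume x: "x \<in> {-1..1}"
  show "((\<lambda>x. (1 - x) powr a * R x) \<longlongrightarrow> (1 - x) powr a * R x) (at x within {-1..1})"
  proof (cases "x = 1")
    case True
    have "((\<lambda>x. (1 - x) powr a * R x) \<longlongrightarrow> 0) (at 1 within {-1..1})"
      by (rule Lim_null_comparison[OF _ tendsto_one_minus_powr[OF b(1), of C]])
         (use b(2) in \<open>auto simp: eventually_at_filter intro!: always_eventually\<close>)
    with True show ?thesis by simp
  next
    case False
    moreover have "(R \<longlongrightarrow> R x) (at x within {-1..1})"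
      using R x by (simp add: continuous_on_def)
    ultimately show ?thesis by (intro tendsto_intros) auto
  qed
qed

lemma flat_powr_bound:
  fixes a :: real
  assumes "flat m R"
  shows "\<exists>C. \<forall>x\<in>{-1..1}. \<bar>(1 - x) powr a * R x\<bar> \<le> C * (1 - x) powr (a + real m)"
proof -
  from flat_bound[OF assms] obtain C where C: "\<And>x. x \<in> {-1..1} \<Longrightarrow> \<bar>R x\<bar> \<le> C * (1 - x) ^ m" by blast
  have "\<bar>(1 - x) powr a * R x\<bar> \<le> C * (1 - x) powr (a + real m)" if x: "x \<in> {-1..1}" for x
  proof (cases "x = 1")
    case False
    with x have "\<bar>(1 - x) powr a * R x\<bar> \<le> (1 - x) powr a * (C * (1 - x) ^ m)"
      unfolding abs_mult by (intro mult_mono C) auto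
    also have "\<dots> = C * (1 - x) powr (a + real m)"
      using False x by (simp add: powr_add powr_realpow)
    finally show ?thesis .
  qed simp
  then show ?thesis by blast
qed

text \<open>
  Differentiating either lowers the order of flatness by one or lowers the exponent by one, so
  \<open>a + m\<close> drops by one with each derivative.  The exponent may become negative on the way; at
  \<open>x = 1\<close> all the functions involved have the value \<open>0\<close>, because \<open>0 powr a = 0\<close> for every \<open>a\<close>,
  and \<open>flat_powr_bound\<close> shows that this value is the correct one.
\<close>
lemma cont_diff_powr_mult_flat:
  fixes a :: real
  assumes "flat m R" "k \<le> m" "a + real m > real k"
  shows "cont_diff k (\<lambda>x. (1 - x) powr a * R x)"
  using assms
proof (induction k arbitrary: m a R)
  case 0
  obtain C where "\<And>x. x \<in> {-1..1} \<Longrightarrow> \<bar>(1 - x) powr a * R x\<bar> \<le> C * (1 - x) powr (a + real m)"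
    using flat_powr_bound[OF 0(1), of a] by blast
  from continuous_on_one_minus_powr_mult[OF flat_continuous_on[OF 0(1)] _ this] 0(3)
  show ?case by simp
next
  case (Suc k)
  obtain C where C: "\<And>x. x \<in> {-1..1} \<Longrightarrow> \<bar>(1 - x) powr a * R x\<bar> \<le> C * (1 - x) powr (a + real m)"
    using flat_powr_bound[OF Suc.prems(1), of a] by blast
  obtain l where l: "m = Suc l" using Suc.prems(2) by (cases m) auto
  from Suc.prems(1) obtain R' where R': "R 1 = 0"
    "\<And>x. x \<in> {-1..1} \<Longrightarrow> (R has_real_derivative R' x) (at x within {-1..1})" "flat l R'"
    unfolding l by (rule flatE) blast
  show ?case
  proof (rule cont_diff_SucI)
    show "((\<lambda>x. (1 - x) powr a * R x) has_real_derivative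
           (1 - x) powr a * R' x + - a * ((1 - x) powr (a - 1) * R x)) (at x within {-1..1})"
      if "x \<in> {-1..1}" for x
      using that R'(2)[OF that] _ C by (rule has_real_derivative_one_minus_powr_mult) (use Suc.prems(3) in simp)
    show "cont_diff k (\<lambda>x. (1 - x) powr a * R' x + - a * ((1 - x) powr (a - 1) * R x))"
      using Suc.prems l R'(3)
      by (intro cont_diff_add cont_diff_mult[OF cont_diff_const] Suc.IH[of l] Suc.IH[of m]) auto
  qed
qed

lemma cont_diff_one_minus_powr:
  "a > real k \<Longrightarrow> cont_diff k (\<lambda>x. (1 - x) powr a)"
proof (induction k arbitrary: a)
  case 0
  then show ?case by (auto intro!: continuous_intros continuous_on_powr')
next
  case (Suc k)
  show ?case
  proof (rule cont_diff_SucI)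
    show "((\<lambda>x. (1 - x) powr a) has_real_derivative - a * (1 - x) powr (a - 1)) (at x within {-1..1})"
      if "x \<in> {-1..1}" for x
      using has_real_derivative_one_minus_powr_mult[OF that DERIV_const[of 1], of a a 1] Suc.prems by simp
    show "cont_diff k (\<lambda>x. - a * (1 - x) powr (a - 1))"
      using Suc.prems by (intro cont_diff_mult[OF cont_diff_const] Suc.IH) simp
  qed
qed

lemma powr_bigo_mono:
  "a \<le> b \<Longrightarrow> (\<lambda>n. real n powr a) \<in> O(\<lambda>n. real n powr b)"
  by (rule bigoI[of _ 1], rule eventually_sequentiallyI[of 1]) (simp add: powr_mono)

text \<open>
  The Taylor polynomial of \<open>h\<close> at \<open>1\<close>, rewritten in powers of \<open>1 - x\<close>, yields the terms \<open>S i\<close>, of which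
  \<open>i = 0\<close> dominates.  The remainder \<open>R\<close> has \<open>K\<close> derivatives, and the lower bound on \<open>K\<close> says exactly
  that its order \<open>1 - K / 2\<close> is at most \<open>- 2 * a - 2\<close>.
\<close>
lemma cc_error_one_minus_powr_mult_bigo:
  assumes a: "a > 0" "a \<notin> \<int>" and h: "cont_diff K h" and K: "real K \<ge> 4 * a + 6"
  shows "(\<lambda>n. cc_error n (\<lambda>x. (1 - x) powr a * h x)) \<in> O(\<lambda>n. real n powr (- 2 * a - 2))"
proof -
  obtain p where p: "flat K (\<lambda>x. h x - poly p x)" using ex_poly_flat_diff[OF h] by blast
  define q where "q = pcompose p [:1, -1:]"
  define R where "R = (\<lambda>x. (1 - x) powr a * (h x - poly p x))"
  define S where "S = (\<lambda>i x. coeff q i * (1 - x) powr (a + real i))"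
  have cdR: "cont_diff K R"
    unfolding R_def using a by (intro cont_diff_powr_mult_flat[OF p]) auto
  have contS: "continuous_on {-1..1} (S i)" for i
    unfolding S_def using a by (intro continuous_intros continuous_on_powr') auto
  have contSum: "continuous_on {-1..1} (\<lambda>x. \<Sum>i\<le>degree q. S i x)"
    by (intro continuous_on_sum contS)
  have split: "(1 - x) powr a * h x = R x + (\<Sum>i\<le>degree q. S i x)" if x: "x \<in> {-1..1}" for x
  proof -
    have "poly p x = poly q (1 - x)" by (simp add: q_def poly_pcompose)
    also have "(1 - x) powr a * \<dots> = (\<Sum>i\<le>degree q. S i x)"
    proof (cases "x = 1")
      case False
      with x have "1 - x > 0" by simp
      then show ?thesis
        by (simp add: poly_altdef sum_distrib_left S_def powr_add powr_realpow mult_ac)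
    qed (simp add: S_def)
    finally show ?thesis by (simp add: R_def algebra_simps)
  qed
  have eq: "cc_error n (\<lambda>x. (1 - x) powr a * h x) = cc_error n R + (\<Sum>i\<le>degree q. cc_error n (S i))" for n
  proof -
    have "cc_error n (\<lambda>x. (1 - x) powr a * h x) = cc_error n (\<lambda>x. R x + (\<Sum>i\<le>degree q. S i x))"
      by (rule cc_error_cong) (rule split)
    also have "\<dots> = cc_error n R + cc_error n (\<lambda>x. \<Sum>i\<le>degree q. S i x)"
      by (rule cc_error_add[OF cont_diff_continuous_on[OF cdR] contSum])
    also have "cc_error n (\<lambda>x. \<Sum>i\<le>degree q. S i x) = (\<Sum>i\<le>degree q. cc_error n (S i))"
      by (rule cc_error_sum[OF _ contS]) simp
    finally show ?thesis .
  qed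
  have S: "(\<lambda>n. cc_error n (S i)) \<in> O(\<lambda>n. real n powr (- 2 * a - 2))" for i
  proof -
    have nonint: "a + real i \<notin> \<int>"
    proof
      assume "a + real i \<in> \<int>"
      then have "a + real i - real i \<in> \<int>" by (intro Ints_diff Ints_of_nat)
      with a(2) show False by simp
    qed
    have "(\<lambda>n. cc_error n (\<lambda>x. (1 - x) powr (a + real i))) \<in> O(\<lambda>n. real n powr (- 2 * (a + real i) - 2))"
      using a(1) nonint by (intro cc_error_one_minus_power_bigo) auto
    also have "(\<lambda>n. real n powr (- 2 * (a + real i) - 2)) \<in> O(\<lambda>n. real n powr (- 2 * a - 2))"
      by (rule powr_bigo_mono) simp
    finally show ?thesis unfolding S_def cc_error_cmult by simp
  qed
  have R: "(\<lambda>n. cc_error n R) \<in> O(\<lambda>n. real n powr (- 2 * a - 2))"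
    by (rule landau_o.big_trans[OF cc_error_cont_diff_bigo[OF cdR] powr_bigo_mono]) (use K in simp)
  show ?thesis unfolding eq by (rule sum_in_bigo(1)[OF R big_sum_in_bigo[OF S]])
qed

lemma cc_error_one_plus_powr_mult_bigo:
  assumes a: "a > 0" "a \<notin> \<int>" and h: "cont_diff K h" and K: "real K \<ge> 4 * a + 6"
  shows "(\<lambda>n. cc_error n (\<lambda>x. (1 + x) powr a * h x)) \<in> O(\<lambda>n. real n powr (- 2 * a - 2))"
proof -
  have "(\<lambda>n. cc_error n (\<lambda>x. (1 - x) powr a * h (- x))) \<in> O(\<lambda>n. real n powr (- 2 * a - 2))"
    using a cont_diff_reflect[OF h] K by (rule cc_error_one_minus_powr_mult_bigo)
  moreover have ev: "\<forall>\<^sub>F n in sequentially. cc_error n (\<lambda>x. (1 - x) powr a * h (- x)) = cc_error n (\<lambda>x. (1 + x) powr a * h x)"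
    using eventually_ge_at_top[of 1]
  proof eventually_elim
    case (elim n)
    then show ?case using cc_error_reflect[of n "\<lambda>x. (1 + x) powr a * h x"] by simp
  qed
  ultimately show ?thesis by (simp only: landau_o.big.in_cong[OF ev])
qed

text \<open>
  Cubing \<open>u a + v b = 1\<close> and sorting the four terms gives
  \<open>u\<^sup>2 (a\<^sup>2 (u a + 3 v b)) + v\<^sup>2 (b\<^sup>2 (3 u a + v b)) = 1\<close>, which doubles the exponents of \<open>1 + x\<close> and
  \<open>1 - x\<close>.
\<close>
lemma one_minus_one_plus_bezout:
  "\<exists>A B :: real poly. \<forall>x. (1 + x) ^ (2 ^ k) * poly A x + (1 - x) ^ (2 ^ k) * poly B x = 1"
proof (induction k)
  case 0
  have "(1 + x) ^ (2 ^ 0) * poly [:1/2:] x + (1 - x) ^ (2 ^ 0) * poly [:1/2:] x = 1" for x :: real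
    by (simp add: field_simps)
  then show ?case by blast
next
  case (Suc k)
  then obtain A B :: "real poly" where AB: "\<And>x. (1 + x) ^ (2 ^ k) * poly A x + (1 - x) ^ (2 ^ k) * poly B x = 1"
    by blast
  define U V where "U = [:1, 1:] ^ (2 ^ k) * A" and "V = [:1, -1:] ^ (2 ^ k) * B"
  have "(1 + x) ^ (2 ^ Suc k) * poly (A\<^sup>2 * (U + 3 * V)) x + (1 - x) ^ (2 ^ Suc k) * poly (B\<^sup>2 * (3 * U + V)) x = 1" for x
  proof -
    define u v where "u = (1 + x) ^ (2 ^ k)" and "v = (1 - x) ^ (2 ^ k)"
    define a b where "a = poly A x" and "b = poly B x"
    have uv: "(1 + x) ^ (2 ^ Suc k) = u\<^sup>2" "(1 - x) ^ (2 ^ Suc k) = v\<^sup>2"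
      by (simp_all add: u_def v_def power_mult mult.commute[of 2])
    have UV: "poly U x = u * a" "poly V x = v * b"
      by (simp_all add: U_def V_def u_def v_def a_def b_def poly_power)
    have "poly 3 x = (3::real)" by (metis poly_of_nat of_nat_numeral)
    then have "u\<^sup>2 * poly (A\<^sup>2 * (U + 3 * V)) x + v\<^sup>2 * poly (B\<^sup>2 * (3 * U + V)) x
        = (u * a) ^ 2 * (u * a + 3 * (v * b)) + (v * b) ^ 2 * (3 * (u * a) + v * b)"
      by (simp add: UV poly_power power_mult_distrib a_def[symmetric] b_def[symmetric])
    also have "\<dots> = (u * a + v * b) ^ 3"
      by (simp add: power2_eq_square power3_eq_cube algebra_simps)
    also have "\<dots> = 1" using AB[of x] by (simp add: u_def v_def a_def b_def)
    finally show ?thesis by (simp only: uv)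
  qed
  then show ?case by blast
qed

lemma rpow_eq_power: "x \<ge> 0 \<Longrightarrow> rpow x (real k) = x ^ k"
  by (cases "k = 0"; cases "x = 0") (auto simp: rpow_def powr_realpow)

text \<open>
  The two summands of the partition of unity are divisible by \<open>(1 + x) ^ N\<close> and \<open>(1 - x) ^ N\<close>.
  The first makes the singularity at \<open>-1\<close> invisible to \<open>K\<close> derivatives and leaves that at \<open>1\<close>;
  the second does the opposite.
\<close>
lemma cc_error_jacobi_bigo:
  assumes a: "a > 0" "a \<notin> \<int>" and b: "b > 0" "b \<notin> \<int>" and g: "\<And>k. cont_diff k g"
  shows "(\<lambda>n. cc_error n (\<lambda>x. (1 - x) powr a * (1 + x) powr b * g x))
         \<in> O(\<lambda>n. real n powr (- 2 * min a b - 2))"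
proof -
  define K where "K = nat \<lceil>4 * max a b + 6\<rceil>"
  have K: "real K \<ge> 4 * a + 6" "real K \<ge> 4 * b + 6" unfolding K_def by linarith+
  define N :: nat where "N = 2 ^ K"
  have NK: "real N > real K" unfolding N_def by (metis less_exp of_nat_less_iff)
  obtain A B :: "real poly" where AB: "\<And>x. (1 + x) ^ N * poly A x + (1 - x) ^ N * poly B x = 1"
    unfolding N_def using one_minus_one_plus_bezout[of K] by blast
  define h1 where "h1 = (\<lambda>x. (1 + x) powr (b + real N) * (poly A x * g x))"
  define h2 where "h2 = (\<lambda>x. (1 - x) powr (a + real N) * (poly B x * g x))"
  have plus: "cont_diff K (\<lambda>x. (1 + x) powr (b + real N))"
    using cont_diff_reflect[OF cont_diff_one_minus_powr[of K "b + real N"]] b NK by simp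
  have h1: "cont_diff K h1"
    unfolding h1_def by (intro cont_diff_mult plus cont_diff_poly g)
  have h2: "cont_diff K h2"
    unfolding h2_def using a NK by (intro cont_diff_mult cont_diff_poly g cont_diff_one_minus_powr) auto
  have split: "(1 - x) powr a * (1 + x) powr b * g x = (1 - x) powr a * h1 x + (1 + x) powr b * h2 x"
    if x: "x \<in> {-1..1}" for x
  proof -
    have pw: "y powr (c + real N) = y powr c * y ^ N" if "y \<ge> 0" "c > 0" for y c :: real
      using that by (cases "y = 0") (auto simp: powr_add powr_realpow)
    have "(1 - x) powr a * h1 x + (1 + x) powr b * h2 x
        = (1 - x) powr a * (1 + x) powr b * g x * ((1 + x) ^ N * poly A x + (1 - x) ^ N * poly B x)"
      using x a b by (simp add: h1_def h2_def pw algebra_simps)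
    then show ?thesis by (simp only: AB mult_1_right)
  qed
  have cont: "continuous_on {-1..1} (\<lambda>x. (1 - x) powr a * h1 x)" "continuous_on {-1..1} (\<lambda>x. (1 + x) powr b * h2 x)"
    using a b cont_diff_continuous_on[OF h1] cont_diff_continuous_on[OF h2]
    by (auto intro!: continuous_intros continuous_on_powr')
  have "cc_error n (\<lambda>x. (1 - x) powr a * (1 + x) powr b * g x)
      = cc_error n (\<lambda>x. (1 - x) powr a * h1 x) + cc_error n (\<lambda>x. (1 + x) powr b * h2 x)" for n
    using cc_error_cong[OF split] cc_error_add[OF cont] by simp
  moreover have "(\<lambda>n. cc_error n (\<lambda>x. (1 - x) powr a * h1 x)) \<in> O(\<lambda>n. real n powr (- 2 * min a b - 2))"
    by (rule landau_o.big_trans[OF cc_error_one_minus_powr_mult_bigo[OF a h1 K(1)] powr_bigo_mono]) simp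
  moreover have "(\<lambda>n. cc_error n (\<lambda>x. (1 + x) powr b * h2 x)) \<in> O(\<lambda>n. real n powr (- 2 * min a b - 2))"
    by (rule landau_o.big_trans[OF cc_error_one_plus_powr_mult_bigo[OF b h2 K(2)] powr_bigo_mono]) simp
  ultimately show ?thesis by (simp add: sum_in_bigo)
qed

lemma nonneg_Ints_real_cases:
  assumes "a \<in> \<int>" "a \<ge> (0::real)"
  obtains k where "a = real k"
  using assms by (metis Ints_cases nonneg_int_cases of_int_0_le_iff of_int_of_nat_eq)

theorem theorem3p6:
  fixes f g :: "real \<Rightarrow> real" and \<alpha> \<beta> s :: real
  assumes "\<alpha> \<ge> 0" and "\<beta> \<ge> 0"
    and "\<not> (\<alpha> \<in> \<int> \<and> \<beta> \<in> \<int>)"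
    and "C_infinity_on {-1..1} g"
    and "\<And>x. x \<in> {-1..1} \<Longrightarrow> f x = rpow (1 - x) \<alpha> * rpow (1 + x) \<beta> * g x"
    and "s = (if \<alpha> \<notin> \<int> \<and> \<beta> \<notin> \<int> then 2 * min \<alpha> \<beta>
              else if \<beta> \<in> \<int> then 2 * \<alpha>
              else 2 * \<beta>)"
  shows "(\<lambda>n. cc_error n f) \<in> O(\<lambda>n. real n powr (- s - 2))"
proof -
  have g: "cont_diff k g" for k by (rule C_infinity_on_imp_cont_diff[OF assms(4)])
  have nonint: "c > 0 \<and> rpow x c = x powr c" if "c \<ge> 0" "c \<notin> \<int>" for c x :: real
    using that by (cases "c = 0") (auto simp: rpow_def)
  consider "\<alpha> \<notin> \<int>" "\<beta> \<notin> \<int>" | "\<alpha> \<notin> \<int>" "\<beta> \<in> \<int>" | "\<alpha> \<in> \<int>" "\<beta> \<notin> \<int>"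
    using assms(3) by blast
  then show ?thesis
  proof cases
    case 1
    have "cc_error n f = cc_error n (\<lambda>x. (1 - x) powr \<alpha> * (1 + x) powr \<beta> * g x)" for n
      using nonint assms(1,2,5) 1 by (intro cc_error_cong) auto
    then show ?thesis
      using cc_error_jacobi_bigo[of \<alpha> \<beta> g] nonint assms(1,2,6) 1 g by simp
  next
    case 2
    obtain k where k: "\<beta> = real k" using 2(2) assms(2) by (rule nonneg_Ints_real_cases)
    define K where "K = nat \<lceil>4 * \<alpha> + 6\<rceil>"
    have K: "real K \<ge> 4 * \<alpha> + 6" unfolding K_def by linarith
    have cd: "cont_diff K (\<lambda>x. poly ([:1, 1:] ^ k) x * g x)"
      by (intro cont_diff_mult cont_diff_poly g)
    have "cc_error n f = cc_error n (\<lambda>x. (1 - x) powr \<alpha> * (poly ([:1, 1:] ^ k) x * g x))" for n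
      using nonint[OF assms(1) 2(1)] assms(5)
      by (intro cc_error_cong) (auto simp: k rpow_eq_power poly_power)
    then show ?thesis
      using cc_error_one_minus_powr_mult_bigo[OF _ 2(1) cd K] nonint[OF assms(1) 2(1)] assms(6) 2 by simp
  next
    case 3
    obtain k where k: "\<alpha> = real k" using 3(1) assms(1) by (rule nonneg_Ints_real_cases)
    define K where "K = nat \<lceil>4 * \<beta> + 6\<rceil>"
    have K: "real K \<ge> 4 * \<beta> + 6" unfolding K_def by linarith
    have cd: "cont_diff K (\<lambda>x. poly ([:1, -1:] ^ k) x * g x)"
      by (intro cont_diff_mult cont_diff_poly g)
    have "cc_error n f = cc_error n (\<lambda>x. (1 + x) powr \<beta> * (poly ([:1, -1:] ^ k) x * g x))" for n
      using nonint[OF assms(2) 3(2)] assms(5)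
      by (intro cc_error_cong) (auto simp: k rpow_eq_power poly_power)
    then show ?thesis
      using cc_error_one_plus_powr_mult_bigo[OF _ 3(2) cd K] nonint[OF assms(2) 3(2)] assms(6) 3 by simp
  qed
qed

end
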